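(* Let $\alpha\in(0,1)$ be an irrational number which is not of bounded type. For $(\beta,\gamma)\in\mathbb{T}^2$ let $\varphi(\beta,\gamma,\cdot)=1_{[0,\beta]}-1_{[\gamma,\beta+\gamma]}$ on $\mathbb{T}^1$. There exists a sequence $(q_{t_k})_{k\ge1}$ of denominators of $\alpha$ (with $(t_k)$ strictly increasing) such that, for the subsequence $L_N=q_{t_1}+\dots+q_{t_N}$, for Lebesgue-a.e. $(\beta,\gamma)$, $$\frac{\sqrt3}{\sqrt N}\sum_{j=1}^{L_N}\varphi(\beta,\gamma,\,\cdot+j\alpha)\ \longrightarrow\ \mathcal N(0,1)\quad\text{in distribution as } N\to\infty .$$
   Context: $\alpha=[0;a_1,a_2,\dots]$ is the continued fraction expansion; the denominators $q_n$ of the convergents satisfy $q_{-1}=0$, $q_0=1$, $q_{n+1}=a_{n+1}q_n+q_{n-1}$. "Bounded type" (constant type) means $\sup_k a_k<\infty$. $\mathbb{T}^1=\mathbb{R}/\mathbb{Z}$ is identified with $[0,1)$, arguments of functions and intervals are taken modulo $1$, parameters $\beta,\gamma$ are taken in $[0,1)$, and convergence in distribution is with respect to Lebesgue measure on $\mathbb{T}^1$ in the variable $x$ (written as a dot). *)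

theory Defs
  imports "HOL-Probability.Probability"
begin

(* Regular continued fraction algorithm.  For irrational alpha in (0,1) it does not terminate, the
   zeroth partial quotient is 0, and all later ones are at least 1. *)
fun complete_quotient :: "real \<Rightarrow> nat \<Rightarrow> real" where
  "complete_quotient \<alpha> 0 = \<alpha>"
| "complete_quotient \<alpha> (Suc n) = 1 / frac (complete_quotient \<alpha> n)"

definition partial_quotient :: "real \<Rightarrow> nat \<Rightarrow> nat" where
  "partial_quotient \<alpha> n = nat \<lfloor>complete_quotient \<alpha> n\<rfloor>"

(* The second equation is the general recursion with the value 0 at index -1 substituted. *)
fun cf_denom :: "real \<Rightarrow> nat \<Rightarrow> nat" where
  "cf_denom \<alpha> 0 = 1"
| "cf_denom \<alpha> (Suc 0) = partial_quotient \<alpha> 1"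
| "cf_denom \<alpha> (Suc (Suc n)) =
     partial_quotient \<alpha> (Suc (Suc n)) * cf_denom \<alpha> (Suc n) + cf_denom \<alpha> n"

definition bounded_type :: "real \<Rightarrow> bool" where
  "bounded_type \<alpha> \<longleftrightarrow> bdd_above (partial_quotient \<alpha> ` {1..})"

(* Functions on the circle R/Z are represented as 1-periodic functions on the reals;
   arc a b is the set of reals whose class modulo 1 lies in the image of [a, b]. *)
definition arc :: "real \<Rightarrow> real \<Rightarrow> real set" where
  "arc a b = {x. \<exists>m::int. x + of_int m \<in> {a..b}}"

definition phi :: "real \<Rightarrow> real \<Rightarrow> real \<Rightarrow> real" where
  "phi \<beta> \<gamma> x = indicator (arc 0 \<beta>) x - indicator (arc \<gamma> (\<beta> + \<gamma>)) x"

end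

theory Submission
  imports Defs
begin

text \<open>
  Up to finitely many points on the circle, \<open>phi \<beta> \<gamma>\<close> is a signed sum of four translates of
  the sawtooth \<open>saw x = frac x - 1/2\<close>.  The sawtooth behaves ideally under rational rotation: if
  \<open>p\<close> is coprime to \<open>q\<close>, the sum of \<open>saw (x + j p / q)\<close> over one period of \<open>j\<close> is \<open>saw (q x)\<close>
  (\<open>saw_sum_rational_rotation\<close>).  If \<open>q\<close> is the denominator of a convergent and the next partial
  quotient is at least \<open>2 ^ k\<close>, then replacing \<open>\<alpha>\<close> by \<open>p / q\<close> in a Birkhoff sum of length \<open>q\<close>
  changes it by at most \<open>8 / 2 ^ k\<close> in the L1 norm (\<open>psi_block_error\<close>).  The partial
  quotients being unbounded, there are denominators \<open>q\<^sub>0, q\<^sub>1, \<dots>\<close> with this property that grow as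
  fast as desired.  The Birkhoff sum of length \<open>q\<^sub>0 + \<dots> + q\<^sub>N\<^sub>-\<^sub>1\<close> is cut into blocks of
  lengths \<open>q\<^sub>k\<close>; the L1 errors of all blocks together are bounded, hence negligible after division
  by \<open>sqrt N\<close>, and the \<open>k\<close>-th block becomes a function \<open>G\<^sub>k (q\<^sub>k x)\<close>.

  Because \<open>q\<^sub>k\<close> is much larger than the sum of its predecessors, the functions \<open>G\<^sub>k (q\<^sub>k x)\<close> are
  nearly independent.  This is made quantitative by the L1 modulus of continuity: if the integral of
  \<open>|F (x + d) - F x|\<close> is at most \<open>M |d|\<close>, then \<open>g (q x)\<close> decouples from \<open>F x\<close> with an error of
  order \<open>M / q\<close> (\<open>circle_decouple\<close>).  Applied to characteristic functions, it gives a central limit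
  theorem for the sum of the \<open>G\<^sub>k (q\<^sub>k x)\<close> whenever the averages of the variances converge
  (\<open>CLT_lacunary\<close>).

  The variance of the \<open>k\<close>-th block is \<open>1/3\<close> plus a combination of the values of the sawtooth
  autocorrelation \<open>corr\<close> at \<open>q\<^sub>k z\<close>, where \<open>z\<close> runs over \<open>\<beta>\<close>, \<open>\<gamma>\<close>, \<open>\<beta> - \<gamma>\<close> and \<open>\<beta> + \<gamma>\<close>
  (\<open>integral_psi_square\<close>).  Since \<open>corr\<close> has mean zero, decoupling also yields a law of large
  numbers, by which the averages of \<open>corr (q\<^sub>k z)\<close> tend to \<open>0\<close> for almost every \<open>z\<close>
  (\<open>LLN_lacunary\<close>).  So for almost every \<open>(\<beta>, \<gamma>)\<close> the averaged variance is \<open>1/3\<close>, which the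
  factor \<open>sqrt 3\<close> normalises to \<open>1\<close>.
\<close>

section \<open>Bounded functions on the circle and their L1 modulus of continuity\<close>

definition circ :: "real measure" where
  "circ = restrict_space lborel {0..<1}"

text \<open>
  Functions on the circle are kept as 1-periodic functions on the reals, so that translations and
  integer dilations need no reduction modulo 1.  The bound is part of the predicate because every
  integrability argument below rests on it.
\<close>
definition circle_fun :: "real \<Rightarrow> (real \<Rightarrow> 'a::{real_normed_field,banach,second_countable_topology}) \<Rightarrow> bool" where
  "circle_fun B f \<longleftrightarrow> f \<in> borel_measurable borel \<and> (\<forall>x. f (x + 1) = f x) \<and> (\<forall>x. norm (f x) \<le> B)"

text \<open>
  Unlike a Lipschitz condition, this holds for step functions and for the sawtooth: a jump of height
  \<open>h\<close> contributes \<open>h\<close> to the constant.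
\<close>
definition L1_lip :: "real \<Rightarrow> (real \<Rightarrow> 'a::{real_normed_field,banach,second_countable_topology}) \<Rightarrow> bool" where
  "L1_lip M f \<longleftrightarrow> (\<forall>d. (\<integral>x. norm (f (x + d) - f x) \<partial>circ) \<le> M * \<bar>d\<bar>)"

lemma space_circ [simp]: "space circ = {0..<1}"
  by (simp add: circ_def space_restrict_space)

lemma prob_space_circ: "prob_space circ"
  by (rule prob_spaceI) (simp add: circ_def space_restrict_space emeasure_restrict_space)

interpretation circ: prob_space circ
  by (rule prob_space_circ)

lemma measure_circ [simp]: "measure circ {0..<1} = 1"
  using circ.prob_space by simp

lemma measurable_circI: "f \<in> borel_measurable borel \<Longrightarrow> f \<in> borel_measurable circ"
  unfolding circ_def by (rule measurable_restrict_space1) simp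

lemma circle_funD:
  assumes "circle_fun B f"
  shows "f \<in> borel_measurable borel" "f (x + 1) = f x" "norm (f x) \<le> B" "0 \<le> B"
  using assms order_trans[OF norm_ge_zero, of "f 0" B] by (auto simp: circle_fun_def)

lemma circle_funI:
  assumes "f \<in> borel_measurable borel" "\<And>x. f (x + 1) = f x" "\<And>x. norm (f x) \<le> B"
  shows "circle_fun B f"
  using assms by (auto simp: circle_fun_def)

lemma periodic_int:
  fixes f :: "real \<Rightarrow> 'a"
  assumes "\<And>x. f (x + 1) = f x"
  shows "f (x + of_int m) = f x"
proof (induction m arbitrary: x rule: int_induct[where k=0])
  case base then show ?case by simp
next
  case (step1 i)
  have "f (x + of_int (i + 1)) = f (x + of_int i + 1)" by (simp add: algebra_simps)
  then show ?case using assms step1 by metis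
next
  case (step2 i)
  have "f (x + of_int i) = f (x + of_int (i - 1) + 1)" by (simp add: algebra_simps)
  then show ?case using assms step2 by metis
qed

lemma circle_fun_int: "circle_fun B f \<Longrightarrow> f (x + of_int m) = f x"
  using periodic_int[of f] circle_funD(2) by blast

lemma circle_fun_int_diff: "circle_fun B f \<Longrightarrow> x - y = of_int m \<Longrightarrow> f x = f y"
  using circle_fun_int[of B f y m] by (simp add: algebra_simps)

lemma circle_fun_shift:
  assumes "circle_fun B f"
  shows "circle_fun B (\<lambda>x. f (x + c))"
proof (rule circle_funI)
  show "(\<lambda>x. f (x + c)) \<in> borel_measurable borel" using circle_funD(1)[OF assms] by measurable
  show "f (x + 1 + c) = f (x + c)" for x
    using circle_funD(2)[OF assms, of "x + c"] by (simp add: algebra_simps)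
qed (use circle_funD[OF assms] in auto)

lemma circle_fun_scale:
  assumes "circle_fun B f"
  shows "circle_fun B (\<lambda>x. f (real q * x + c))"
proof (rule circle_funI)
  show "(\<lambda>x. f (real q * x + c)) \<in> borel_measurable borel" using circle_funD(1)[OF assms] by measurable
  show "f (real q * (x + 1) + c) = f (real q * x + c)" for x
    by (rule circle_fun_int_diff[OF assms, where m="int q"]) (simp add: algebra_simps)
qed (use circle_funD[OF assms] in auto)

lemma circle_fun_mult:
  assumes "circle_fun A f" "circle_fun B g"
  shows "circle_fun (A * B) (\<lambda>x. f x * g x)"
proof (rule circle_funI)
  show "norm (f x * g x) \<le> A * B" for x
    unfolding norm_mult by (intro mult_mono circle_funD(3)[OF assms(1)] circle_funD(3)[OF assms(2)])
       (use circle_funD(4)[OF assms(1)] in auto)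
qed (use circle_funD[OF assms(1)] circle_funD[OF assms(2)] in auto)

lemma circle_fun_add:
  assumes "circle_fun A f" "circle_fun B g"
  shows "circle_fun (A + B) (\<lambda>x. f x + g x)"
proof (rule circle_funI)
  show "norm (f x + g x) \<le> A + B" for x
    by (rule norm_triangle_le) (intro add_mono circle_funD(3)[OF assms(1)] circle_funD(3)[OF assms(2)])
qed (use circle_funD[OF assms(1)] circle_funD[OF assms(2)] in auto)

lemma circle_fun_uminus: "circle_fun A f \<Longrightarrow> circle_fun A (\<lambda>x. - f x)"
  by (auto simp: circle_fun_def)

lemma circle_fun_diff:
  assumes "circle_fun A f" "circle_fun B g"
  shows "circle_fun (A + B) (\<lambda>x. f x - g x)"
  using circle_fun_add[OF assms(1) circle_fun_uminus[OF assms(2)]] by simp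

lemma circle_fun_norm: "circle_fun A f \<Longrightarrow> circle_fun A (\<lambda>x. norm (f x))"
  by (auto simp: circle_fun_def)

lemma circle_fun_sum:
  assumes "finite I" "\<And>i. i \<in> I \<Longrightarrow> circle_fun (A i) (f i)"
  shows "circle_fun (\<Sum>i\<in>I. A i) (\<lambda>x. \<Sum>i\<in>I. f i x)"
  using assms
proof (induction I)
  case empty then show ?case by (simp add: circle_fun_def)
next
  case (insert a I) then show ?case using circle_fun_add[of "A a" "f a"] by simp
qed

lemma integrable_circle_fun [intro]: "circle_fun B f \<Longrightarrow> integrable circ f"
  by (rule circ.integrable_const_bound[where B=B]) (auto simp: circle_funD intro: measurable_circI)

lemma norm_integral_circle_fun_le:
  assumes "circle_fun B f"
  shows "norm (\<integral>x. f x \<partial>circ) \<le> B"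
proof -
  have "norm (\<integral>x. f x \<partial>circ) \<le> (\<integral>x. norm (f x) \<partial>circ)" by (rule integral_norm_bound)
  also have "\<dots> \<le> B"
    using assms by (intro circ.integral_le_const integrable_norm) (auto simp: circle_funD)
  finally show ?thesis .
qed

lemma circ_integral_eq:
  fixes f :: "real \<Rightarrow> 'a::{banach,second_countable_topology}"
  shows "(\<integral>x. f x \<partial>circ) = (\<integral>x. indicator {0..<1} x *\<^sub>R f x \<partial>lborel)"
  unfolding circ_def by (subst integral_restrict_space) auto

lemma integral_circ_translate:
  assumes f: "circle_fun B f"
  shows "(\<integral>x. f (x + c) \<partial>circ) = (\<integral>x. f x \<partial>circ)"
proof -
  have [measurable]: "f \<in> borel_measurable borel" by (rule circle_funD(1)[OF f])
  define d where "d = frac c"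
  have d: "0 \<le> d" "d < 1" by (auto simp: d_def frac_lt_1)
  have fd: "f (x + c) = f (x + d)" for x
    by (rule circle_fun_int_diff[OF f, where m="\<lfloor>c\<rfloor>"]) (simp add: d_def frac_def)
  have int: "integrable lborel (\<lambda>x. indicator {a..<b} x *\<^sub>R f x)" for a b :: real
  proof (rule Bochner_Integration.integrable_bound)
    show "integrable lborel (\<lambda>x. indicator {a..<b} x *\<^sub>R B)" 
      by (intro integrable_scaleR_left impI integrable_real_indicator) (cases "a \<le> b"; simp)+
  qed (auto simp: indicator_def circle_funD[OF f] intro: order_trans[OF circle_funD(3)[OF f] abs_ge_self])
  have "(\<integral>x. f (x + c) \<partial>circ) = (\<integral>x. indicator {0..<1} x *\<^sub>R f (x + d) \<partial>lborel)"
    by (simp add: circ_integral_eq fd)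
  also have "\<dots> = (\<integral>x. indicator {0..<1} (- d + 1 * x) *\<^sub>R f (- d + 1 * x + d) \<partial>lborel)"
    by (subst lborel_integral_real_affine[where c=1 and t="-d"]) auto
  also have "\<dots> = (\<integral>x. indicator {d..<1} x *\<^sub>R f x + indicator {1..<1+d} x *\<^sub>R f x \<partial>lborel)"
    by (intro Bochner_Integration.integral_cong) (use d in \<open>auto simp: indicator_def\<close>)
  also have "\<dots> = (\<integral>x. indicator {d..<1} x *\<^sub>R f x \<partial>lborel) + (\<integral>x. indicator {1..<1+d} x *\<^sub>R f x \<partial>lborel)"
    by (intro Bochner_Integration.integral_add int)
  also have "(\<integral>x. indicator {1..<1+d} x *\<^sub>R f x \<partial>lborel)
      = (\<integral>x. indicator {1..<1+d} (1 + 1 * x) *\<^sub>R f (1 + 1 * x) \<partial>lborel)"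
    by (subst lborel_integral_real_affine[where c=1 and t="1"]) auto
  also have "\<dots> = (\<integral>x. indicator {0..<d} x *\<^sub>R f x \<partial>lborel)"
    by (intro Bochner_Integration.integral_cong) (use circle_funD(2)[OF f] in \<open>auto simp: indicator_def add.commute\<close>)
  also have "(\<integral>x. indicator {d..<1} x *\<^sub>R f x \<partial>lborel) + (\<integral>x. indicator {0..<d} x *\<^sub>R f x \<partial>lborel)
      = (\<integral>x. indicator {d..<1} x *\<^sub>R f x + indicator {0..<d} x *\<^sub>R f x \<partial>lborel)"
    by (intro Bochner_Integration.integral_add[symmetric] int)
  also have "\<dots> = (\<integral>x. indicator {0..<1} x *\<^sub>R f x \<partial>lborel)"
    by (intro Bochner_Integration.integral_cong) (use d in \<open>auto simp: indicator_def\<close>)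
  finally show ?thesis by (simp add: circ_integral_eq)
qed

text \<open>
  The inner average over \<open>u\<close> is a full translation average of \<open>g\<close>, whatever the phase \<open>q x\<close> is.
\<close>
lemma circle_fubini:
  assumes F: "circle_fun A F" and g: "circle_fun B g"
  shows "(\<integral>u. (\<integral>x. F x * g (real q * x + u) \<partial>circ) \<partial>circ) = (\<integral>x. F x \<partial>circ) * (\<integral>x. g x \<partial>circ)"
proof -
  interpret P: pair_prob_space circ circ ..
  have [measurable]: "F \<in> borel_measurable borel" "g \<in> borel_measurable borel"
    by (rule circle_funD(1)[OF F], rule circle_funD(1)[OF g])
  have [measurable]: "(\<lambda>x. x) \<in> borel_measurable circ" by (rule measurable_circI) simp
  have "integrable (circ \<Otimes>\<^sub>M circ) (\<lambda>(x, u). F x * g (real q * x + u))"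
  proof (rule P.P.integrable_const_bound[where B="A * B"])
    show "AE xu in circ \<Otimes>\<^sub>M circ. norm (case xu of (x, u) \<Rightarrow> F x * g (real q * x + u)) \<le> A * B"
      by (auto simp: norm_mult split_beta intro!: mult_mono circle_funD(3)[OF F] circle_funD(3)[OF g] circle_funD(4)[OF F])
  qed measurable
  from P.Fubini_integral[OF this]
  have "(\<integral>u. (\<integral>x. F x * g (real q * x + u) \<partial>circ) \<partial>circ) = (\<integral>x. (\<integral>u. F x * g (real q * x + u) \<partial>circ) \<partial>circ)"
    by simp
  also have "\<dots> = (\<integral>x. F x * (\<integral>u. g u \<partial>circ) \<partial>circ)"
  proof (rule Bochner_Integration.integral_cong[OF refl])
    fix x
    have "integrable circ (\<lambda>u. g (real q * x + u))"
      using circle_fun_shift[OF g, of "real q * x"] by (auto simp: add.commute)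
    then have "(\<integral>u. F x * g (real q * x + u) \<partial>circ) = F x * (\<integral>u. g (real q * x + u) \<partial>circ)"
      by simp
    also have "(\<integral>u. g (real q * x + u) \<partial>circ) = (\<integral>u. g u \<partial>circ)"
      using integral_circ_translate[OF g, of "real q * x"] by (simp add: add.commute)
    finally show "(\<integral>u. F x * g (real q * x + u) \<partial>circ) = F x * (\<integral>u. g u \<partial>circ)" .
  qed
  also have "\<dots> = (\<integral>x. F x \<partial>circ) * (\<integral>x. g x \<partial>circ)"
    by simp
  finally show ?thesis .
qed

lemma L1_lipD: "L1_lip M f \<Longrightarrow> (\<integral>x. norm (f (x + d) - f x) \<partial>circ) \<le> M * \<bar>d\<bar>"
  by (simp add: L1_lip_def)

lemma L1_shift:
  assumes f: "circle_fun B f" "L1_lip M f"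
  shows "(\<integral>x. norm (f (x + a) - f (x + b)) \<partial>circ) \<le> M * \<bar>a - b\<bar>"
proof -
  have "(\<integral>x. norm (f (x + a) - f (x + b)) \<partial>circ) = (\<integral>x. norm (f (x + (a - b)) - f x) \<partial>circ)"
    using integral_circ_translate[OF circle_fun_norm[OF circle_fun_diff[OF circle_fun_shift[OF f(1), of "a - b"] f(1)]], of b]
    by simp
  also have "\<dots> \<le> M * \<bar>a - b\<bar>" by (rule L1_lipD[OF f(2)])
  finally show ?thesis .
qed

text \<open>
  Translating by \<open>u / q\<close> moves \<open>F\<close> by at most \<open>M u / q\<close> in L1, but moves the phase of \<open>g (q x)\<close> by
  the macroscopic amount \<open>u\<close>.  So the left integral is within \<open>B M / q\<close> of the integral of
  \<open>F x * g (q x + u)\<close> for every \<open>u\<close> between 0 and 1, and averaging over \<open>u\<close> separates the factors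
  by \<open>circle_fubini\<close>.
\<close>
lemma circle_decouple:
  assumes F: "circle_fun A F" "L1_lip M F" and g: "circle_fun B g" and q: "q > 0"
  shows "norm ((\<integral>x. F x * g (real q * x) \<partial>circ) - (\<integral>x. F x \<partial>circ) * (\<integral>x. g x \<partial>circ)) \<le> B * M / real q"
proof -
  define I where "I = (\<integral>x. F x * g (real q * x) \<partial>circ)"
  define J where "J u = (\<integral>x. F x * g (real q * x + u) \<partial>circ)" for u
  have M: "0 \<le> M" using L1_lipD[OF F(2), of 1] circle_funD(2)[OF F(1)] by simp
  have B: "0 \<le> B" using circle_funD(4)[OF g] .
  note gq = circle_fun_scale[OF g, of q]
  have diff: "norm (I - J u) \<le> B * M / real q" if u: "u \<in> {0..<1}" for u
  proof -
    have "I = (\<integral>x. F (x + u / real q) * g (real q * (x + u / real q)) \<partial>circ)"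
      unfolding I_def using integral_circ_translate[OF circle_fun_mult[OF F(1) gq[of 0]], of "u / real q"]
      by simp
    also have "\<dots> = (\<integral>x. F (x + u / real q) * g (real q * x + u) \<partial>circ)"
      using q by (simp add: algebra_simps)
    finally have "I - J u = (\<integral>x. F (x + u / real q) * g (real q * x + u) - F x * g (real q * x + u) \<partial>circ)"
      unfolding J_def
      by (simp add: Bochner_Integration.integral_diff[OF integrable_circle_fun[OF circle_fun_mult[OF circle_fun_shift[OF F(1)] gq]]
          integrable_circle_fun[OF circle_fun_mult[OF F(1) gq]]])
    also have "norm \<dots> \<le> (\<integral>x. norm (F (x + u / real q) - F x) * B \<partial>circ)"
    proof (rule Bochner_Integration.integral_norm_bound_integral)
      show "integrable circ (\<lambda>x. F (x + u / real q) * g (real q * x + u) - F x * g (real q * x + u))"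
        by (rule integrable_circle_fun[OF circle_fun_diff[OF circle_fun_mult[OF circle_fun_shift[OF F(1)] gq] circle_fun_mult[OF F(1) gq]]])
      have "integrable circ (\<lambda>x. norm (F (x + u / real q) - F x))"
        by (rule integrable_circle_fun[OF circle_fun_norm[OF circle_fun_diff[OF circle_fun_shift[OF F(1)] F(1)]]])
      then show "integrable circ (\<lambda>x. norm (F (x + u / real q) - F x) * B)" by simp
      show "norm (F (x + u / real q) * g (real q * x + u) - F x * g (real q * x + u)) \<le> norm (F (x + u / real q) - F x) * B" for x
        unfolding left_diff_distrib[symmetric] norm_mult
        by (intro mult_left_mono circle_funD(3)[OF g]) auto
    qed
    also have "\<dots> = B * (\<integral>x. norm (F (x + u / real q) - F x) \<partial>circ)" by simp
    also have "\<dots> \<le> B * (M * \<bar>u / real q\<bar>)"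
      by (intro mult_left_mono L1_lipD F B)
    also have "\<dots> = B * M * (u / real q)" using u by simp
    also have "\<dots> \<le> B * M * (1 / real q)"
      using u M B q by (intro mult_left_mono divide_right_mono) auto
    finally show ?thesis by simp
  qed
  interpret P: pair_prob_space circ circ ..
  have [measurable]: "F \<in> borel_measurable borel" "g \<in> borel_measurable borel"
    by (rule circle_funD(1)[OF F(1)], rule circle_funD(1)[OF g])
  have [measurable]: "(\<lambda>x. x) \<in> borel_measurable circ" by (rule measurable_circI) simp
  have Jint: "integrable circ J"
  proof (rule circ.integrable_const_bound[where B="A * B"])
    show "J \<in> borel_measurable circ" unfolding J_def by measurable
    show "AE u in circ. norm (J u) \<le> A * B" unfolding J_def
      by (intro AE_I2 norm_integral_circle_fun_le[OF circle_fun_mult[OF F(1) gq]])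
  qed
  have "I - (\<integral>x. F x \<partial>circ) * (\<integral>x. g x \<partial>circ) = (\<integral>u. I - J u \<partial>circ)"
    using Jint circle_fubini[OF F(1) g, where q=q] by (simp add: J_def[symmetric])
  also have "norm \<dots> \<le> (\<integral>u. norm (I - J u) \<partial>circ)" by (rule integral_norm_bound)
  also have "\<dots> \<le> B * M / real q"
    using Jint diff by (intro circ.integral_le_const integrable_norm) auto
  finally show ?thesis by (simp add: I_def)
qed

text \<open>
  The constant function 1 decouples from \<open>g (q x)\<close> without error.
\<close>
lemma integral_circ_scale:
  assumes g: "circle_fun B g" and q: "q > 0"
  shows "(\<integral>x. g (real q * x) \<partial>circ) = (\<integral>x. g x \<partial>circ)"
  using circle_decouple[of 1 "\<lambda>x. 1" 0 B g q] assms by (simp add: circle_fun_def L1_lip_def circ.prob_space)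

lemma L1_lip_add:
  assumes "circle_fun A f" "L1_lip L f" "circle_fun B g" "L1_lip M g"
  shows "L1_lip (L + M) (\<lambda>x. f x + g x)"
  unfolding L1_lip_def
proof
  fix d
  note int = integrable_circle_fun[OF circle_fun_norm[OF circle_fun_diff[OF circle_fun_shift[of _ _ d]]]]
  have "(\<integral>x. norm (f (x + d) + g (x + d) - (f x + g x)) \<partial>circ)
      \<le> (\<integral>x. norm (f (x + d) - f x) + norm (g (x + d) - g x) \<partial>circ)"
  proof (rule integral_mono)
    show "integrable circ (\<lambda>x. norm (f (x + d) + g (x + d) - (f x + g x)))"
      using int[OF circle_fun_add[OF assms(1,3)] circle_fun_add[OF assms(1,3)]] by simp
    show "integrable circ (\<lambda>x. norm (f (x + d) - f x) + norm (g (x + d) - g x))"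
      by (intro Bochner_Integration.integrable_add int[OF assms(1) assms(1)] int[OF assms(3) assms(3)])
    show "norm (f (x + d) + g (x + d) - (f x + g x)) \<le> norm (f (x + d) - f x) + norm (g (x + d) - g x)" for x
      using norm_triangle_ineq[of "f (x + d) - f x" "g (x + d) - g x"] by (simp add: algebra_simps)
  qed
  also have "\<dots> = (\<integral>x. norm (f (x + d) - f x) \<partial>circ) + (\<integral>x. norm (g (x + d) - g x) \<partial>circ)"
    by (intro Bochner_Integration.integral_add int[OF assms(1) assms(1)] int[OF assms(3) assms(3)])
  also have "\<dots> \<le> L * \<bar>d\<bar> + M * \<bar>d\<bar>" by (intro add_mono L1_lipD assms)
  finally show "(\<integral>x. norm (f (x + d) + g (x + d) - (f x + g x)) \<partial>circ) \<le> (L + M) * \<bar>d\<bar>"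
    by (simp add: algebra_simps)
qed

lemma L1_lip_mult:
  assumes f: "circle_fun A f" "L1_lip L f" and g: "circle_fun B g" "L1_lip M g"
  shows "L1_lip (L * B + A * M) (\<lambda>x. f x * g x)"
  unfolding L1_lip_def
proof
  fix d
  note int = integrable_circle_fun[OF circle_fun_norm[OF circle_fun_diff[OF circle_fun_shift[of _ _ d]]]]
  have "(\<integral>x. norm (f (x + d) * g (x + d) - f x * g x) \<partial>circ)
      \<le> (\<integral>x. norm (f (x + d) - f x) * B + A * norm (g (x + d) - g x) \<partial>circ)"
  proof (rule integral_mono)
    show "integrable circ (\<lambda>x. norm (f (x + d) * g (x + d) - f x * g x))"
      using int[OF circle_fun_mult[OF f(1) g(1)] circle_fun_mult[OF f(1) g(1)]] by simp
    show "integrable circ (\<lambda>x. norm (f (x + d) - f x) * B + A * norm (g (x + d) - g x))"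
      by (intro Bochner_Integration.integrable_add integrable_mult_left integrable_mult_right
          int[OF f(1) f(1)] int[OF g(1) g(1)])
    fix x
    have "f (x + d) * g (x + d) - f x * g x = (f (x + d) - f x) * g (x + d) + f x * (g (x + d) - g x)"
      by (simp add: algebra_simps)
    also have "norm \<dots> \<le> norm (f (x + d) - f x) * norm (g (x + d)) + norm (f x) * norm (g (x + d) - g x)"
      by (rule norm_triangle_le) (simp add: norm_mult)
    also have "\<dots> \<le> norm (f (x + d) - f x) * B + A * norm (g (x + d) - g x)"
      by (intro add_mono mult_left_mono mult_right_mono circle_funD(3)[OF f(1)] circle_funD(3)[OF g(1)]) auto
    finally show "norm (f (x + d) * g (x + d) - f x * g x) \<le> \<dots>" .
  qed
  also have "\<dots> = (\<integral>x. norm (f (x + d) - f x) \<partial>circ) * B + A * (\<integral>x. norm (g (x + d) - g x) \<partial>circ)"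
    using int[OF f(1) f(1)] int[OF g(1) g(1)] by (subst Bochner_Integration.integral_add) auto
  also have "\<dots> \<le> (L * \<bar>d\<bar>) * B + A * (M * \<bar>d\<bar>)"
    by (intro add_mono mult_left_mono mult_right_mono L1_lipD assms circle_funD(4)[OF f(1)] circle_funD(4)[OF g(1)])
  finally show "(\<integral>x. norm (f (x + d) * g (x + d) - f x * g x) \<partial>circ) \<le> (L * B + A * M) * \<bar>d\<bar>"
    by (simp add: algebra_simps)
qed

lemma L1_lip_shift:
  assumes "circle_fun A f" "L1_lip L f"
  shows "L1_lip L (\<lambda>x. f (x + c))"
  unfolding L1_lip_def
proof
  fix d
  have "(\<integral>x. norm (f (x + d + c) - f (x + c)) \<partial>circ) = (\<integral>x. norm (f (x + d) - f x) \<partial>circ)"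
    using integral_circ_translate[OF circle_fun_norm[OF circle_fun_diff[OF circle_fun_shift[OF assms(1), of d] assms(1)]], of c]
    by (simp add: algebra_simps)
  also have "\<dots> \<le> L * \<bar>d\<bar>" by (rule L1_lipD[OF assms(2)])
  finally show "(\<integral>x. norm (f (x + d + c) - f (x + c)) \<partial>circ) \<le> L * \<bar>d\<bar>" .
qed

lemma L1_lip_scale:
  assumes "circle_fun A f" "L1_lip L f" "q > 0"
  shows "L1_lip (L * real q) (\<lambda>x. f (real q * x))"
  unfolding L1_lip_def
proof
  fix d
  have "(\<integral>x. norm (f (real q * (x + d)) - f (real q * x)) \<partial>circ) = (\<integral>x. norm (f (x + real q * d) - f x) \<partial>circ)"
    using integral_circ_scale[OF circle_fun_norm[OF circle_fun_diff[OF circle_fun_shift[OF assms(1), of "real q * d"] assms(1)]] assms(3)]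
    by (simp add: algebra_simps)
  also have "\<dots> \<le> L * \<bar>real q * d\<bar>" by (rule L1_lipD[OF assms(2)])
  finally show "(\<integral>x. norm (f (real q * (x + d)) - f (real q * x)) \<partial>circ) \<le> L * real q * \<bar>d\<bar>"
    by (simp add: abs_mult)
qed

lemma L1_lip_uminus: "L1_lip L f \<Longrightarrow> L1_lip L (\<lambda>x. - f x)"
  by (simp add: L1_lip_def norm_minus_commute)

lemma L1_lip_const: "L1_lip 0 (\<lambda>x. c)"
  by (simp add: L1_lip_def)

lemma L1_lip_sum:
  assumes "finite I" "\<And>i. i \<in> I \<Longrightarrow> circle_fun (A i) (f i)" "\<And>i. i \<in> I \<Longrightarrow> L1_lip (L i) (f i)"
  shows "L1_lip (\<Sum>i\<in>I. L i) (\<lambda>x. \<Sum>i\<in>I. f i x)"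
  using assms
proof (induction I)
  case empty then show ?case using L1_lip_const by simp
next
  case (insert a I)
  then show ?case using L1_lip_add[OF _ _ circle_fun_sum[of I A f], of "A a" "f a" "L a"] by simp
qed

section \<open>The sawtooth function and its autocorrelation\<close>

definition saw :: "real \<Rightarrow> real" where
  "saw x = frac x - 1/2"

lemma saw_periodic: "saw (x + of_int m) = saw x"
  by (simp add: saw_def frac_def)

lemma abs_saw_le: "\<bar>saw x\<bar> \<le> 1/2"
  using frac_lt_1[of x] frac_ge_0[of x] unfolding saw_def abs_le_iff by linarith

lemma circle_fun_saw: "circle_fun (1/2) saw"
proof (rule circle_funI)
  show "saw \<in> borel_measurable borel" unfolding saw_def frac_def by measurable
  show "saw (x + 1) = saw x" for x using saw_periodic[of x 1] by simp
qed (use abs_saw_le in simp)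

lemma integral_saw_powers:
  shows "(\<integral>x. saw x \<partial>circ) = 0" "(\<integral>x. saw x * saw x \<partial>circ) = 1/12"
proof -
  have "(\<integral>x. saw x \<partial>circ) = (\<integral>x. indicator {0..<1} x *\<^sub>R (x - 1/2) \<partial>lborel)"
    unfolding circ_integral_eq by (intro Bochner_Integration.integral_cong refl) (simp add: saw_def indicator_def frac_eq)
  also have "\<dots> = (\<integral>x. (x - 1/2) * indicator {0..1} x \<partial>lborel)"
  proof (rule integral_cong_AE)
    show "AE x in lborel. indicator {0..<1} x *\<^sub>R (x - 1/2) = (x - 1/2) * indicator {0..1} (x::real)"
      using AE_lborel_singleton[of 1] by eventually_elim (auto simp: indicator_def)
  qed auto
  also have "\<dots> = (1^2/2 - 1/2) - (0^2/2 - 0/2)"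
    by (rule integral_FTC_Icc_real[where F="\<lambda>x. x^2/2 - x/2"])
       (auto intro!: derivative_eq_intros continuous_intros)
  finally show "(\<integral>x. saw x \<partial>circ) = 0" by simp
  have "(\<integral>x. saw x * saw x \<partial>circ) = (\<integral>x. indicator {0..<1} x *\<^sub>R ((x - 1/2) * (x - 1/2)) \<partial>lborel)"
    unfolding circ_integral_eq by (intro Bochner_Integration.integral_cong refl) (simp add: saw_def indicator_def frac_eq)
  also have "\<dots> = (\<integral>x. ((x - 1/2) * (x - 1/2)) * indicator {0..1} x \<partial>lborel)"
  proof (rule integral_cong_AE)
    show "AE x in lborel. indicator {0..<1} x *\<^sub>R ((x - 1/2) * (x - 1/2)) = ((x - 1/2) * (x - 1/2)) * indicator {0..1} (x::real)"
      using AE_lborel_singleton[of 1] by eventually_elim (auto simp: indicator_def)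
  qed auto
  also have "\<dots> = (1 - 1/2)^3/3 - (0 - 1/2)^3/3"
    by (rule integral_FTC_Icc_real[where F="\<lambda>x. (x - 1/2)^3/3"])
       (auto intro!: derivative_eq_intros continuous_intros simp: power2_eq_square)
  finally show "(\<integral>x. saw x * saw x \<partial>circ) = 1/12" by (simp add: power3_eq_cube)
qed

text \<open>
  For \<open>d < 1\<close> the difference is \<open>d\<close> except on an interval of length \<open>d\<close> before the jump.
\<close>
lemma L1_lip_saw_nonneg:
  assumes d: "0 \<le> d"
  shows "(\<integral>x. \<bar>saw (x + d) - saw x\<bar> \<partial>circ) \<le> 2 * d"
proof (cases "d < 1")
  case True
  have cf: "circle_fun 1 (\<lambda>x. \<bar>saw (x + d) - saw x\<bar>)"
    using circle_fun_norm[OF circle_fun_diff[OF circle_fun_shift[OF circle_fun_saw] circle_fun_saw]]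
    by simp
  have ind: "integrable circ (indicator {1-d..<1} :: real \<Rightarrow> real)"
    by (rule circ.integrable_const_bound[where B=1]) (auto intro: measurable_circI)
  have "(\<integral>x. \<bar>saw (x + d) - saw x\<bar> \<partial>circ) \<le> (\<integral>x. d + indicator {1-d..<1} x \<partial>circ)"
  proof (rule integral_mono)
    show "integrable circ (\<lambda>x. \<bar>saw (x + d) - saw x\<bar>)" using cf by (rule integrable_circle_fun)
    show "integrable circ (\<lambda>x. d + indicator {1-d..<1} x)" using ind by simp
    fix x assume "x \<in> space circ"
    then have x: "0 \<le> x" "x < 1" by auto
    have fx: "frac x = x" using x by (simp add: frac_eq)
    have "frac (x + d) = (if x + d < 1 then x + d else x + d - 1)"
      using x d True by (auto simp: frac_unique_iff)
    then show "\<bar>saw (x + d) - saw x\<bar> \<le> d + indicator {1-d..<1} x"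
      using x d True by (auto simp: saw_def fx indicator_def abs_le_iff)
  qed
  also have "\<dots> = d + (\<integral>x. indicator {1-d..<1} x \<partial>circ)"
    using ind by simp
  also have "(\<integral>x. (indicator {1-d..<1} x :: real) \<partial>circ) = (\<integral>x. indicator {1-d..<1} x \<partial>lborel)"
    unfolding circ_integral_eq by (intro Bochner_Integration.integral_cong) (use True in \<open>auto simp: indicator_def\<close>)
  also have "\<dots> = d" using d by simp
  finally show ?thesis by simp
next
  case False
  have "circle_fun 1 (\<lambda>x. saw (x + d) - saw x)"
    using circle_fun_diff[OF circle_fun_shift[OF circle_fun_saw] circle_fun_saw] by simp
  from norm_integral_circle_fun_le[OF circle_fun_norm[OF this]] False show ?thesis by simp
qed

lemma L1_lip_saw: "L1_lip 2 saw"
  unfolding L1_lip_def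
proof
  fix d :: real
  show "(\<integral>x. norm (saw (x + d) - saw x) \<partial>circ) \<le> 2 * \<bar>d\<bar>"
  proof (cases "0 \<le> d")
    case True then show ?thesis using L1_lip_saw_nonneg[of d] by simp
  next
    case False
    have "(\<integral>x. norm (saw (x + d) - saw x) \<partial>circ) = (\<integral>x. norm (saw (x - d + d) - saw (x - d)) \<partial>circ)"
      using integral_circ_translate[OF circle_fun_norm[OF circle_fun_diff[OF circle_fun_shift[OF circle_fun_saw, of d] circle_fun_saw]], of "-d"]
      by simp
    also have "\<dots> = (\<integral>x. \<bar>saw (x + (-d)) - saw x\<bar> \<partial>circ)" by (simp add: abs_minus_commute)
    also have "\<dots> \<le> 2 * (-d)" using False by (intro L1_lip_saw_nonneg) simp
    finally show ?thesis using False by simp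
  qed
qed

text \<open>
  The difference of the two sides has period \<open>1 / q\<close>, and on the interval from 0 to \<open>1 / q\<close> no
  argument on the left wraps around, so there the identity is an arithmetic progression.
\<close>
lemma saw_multiplication:
  assumes q: "q > 0"
  shows "(\<Sum>r<q. saw (x + real r / real q)) = saw (real q * x)"
proof -
  define g where "g x = (\<Sum>r<q. saw (x + real r / real q)) - saw (real q * x)" for x
  have step: "g (x + 1 / real q) = g x" for x
  proof -
    have "(\<Sum>r<q. saw (x + 1 / real q + real r / real q)) = (\<Sum>r<q. saw (x + real (Suc r) / real q))"
      by (intro sum.cong) (auto simp: add_divide_distrib algebra_simps)
    also have "\<dots> = (\<Sum>r<q. saw (x + real r / real q))"
      using sum.lessThan_Suc_shift[of "\<lambda>r. saw (x + real r / real q)" q] 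
        sum.lessThan_Suc[of "\<lambda>r. saw (x + real r / real q)" q] q saw_periodic[of x 1] by simp
    moreover have "saw (real q * (x + 1 / real q)) = saw (real q * x)"
      using q saw_periodic[of "real q * x" 1] by (simp add: algebra_simps)
    ultimately show ?thesis by (simp add: g_def)
  qed
  have steps: "g (x + real n / real q) = g x" for x n
  proof (induction n)
    case (Suc n)
    then show ?case using step[of "x + real n / real q"] by (simp add: add_divide_distrib algebra_simps)
  qed simp
  have stepi: "g (x + of_int m / real q) = g x" for x m
  proof (cases "m \<ge> 0")
    case True
    then show ?thesis using steps[of x "nat m"] by simp
  next
    case False
    then show ?thesis using steps[of "x + of_int m / real q" "nat (-m)"] by simp
  qed
  have base: "g x = 0" if x: "0 \<le> x" "x < 1 / real q" for x
  proof -
    have "saw (x + real r / real q) = x + real r / real q - 1/2" if r: "r < q" for r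
    proof -
      have "real q * x < 1" using x q by (simp add: field_simps)
      then have "real q * x + real r < real q" using r by linarith
      then have "x + real r / real q < 1" using q by (simp add: field_simps)
      then show ?thesis using x by (simp add: saw_def frac_eq[THEN iffD2])
    qed
    then have "(\<Sum>r<q. saw (x + real r / real q)) = (\<Sum>r<q. (x - 1/2) + real r / real q)"
      by (intro sum.cong) auto
    also have "\<dots> = real q * (x - 1/2) + (\<Sum>r<q. real r) / real q"
      by (simp add: sum.distrib sum_divide_distrib)
    also have "(\<Sum>r<q. real r) = real q * (real q - 1) / 2"
      by (induction q) (auto simp: field_simps)
    also have "real q * (x - 1/2) + real q * (real q - 1) / 2 / real q = real q * x - 1/2"
      using q by (simp add: field_simps)
    also have "\<dots> = saw (real q * x)"
      using x q by (simp add: saw_def frac_eq[THEN iffD2] field_simps)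
    finally show ?thesis by (simp add: g_def)
  qed
  define m where "m = \<lfloor>real q * x\<rfloor>"
  have "g x = g (x - of_int m / real q)" using stepi[of x "-m"] by simp
  also have "\<dots> = 0"
  proof (rule base)
    have "of_int m \<le> real q * x" "real q * x < of_int m + 1" by (auto simp: m_def)
    then have "of_int m / real q \<le> x" "x < (of_int m + 1) / real q"
      using q by (simp_all add: pos_divide_le_eq pos_less_divide_eq mult.commute)
    then show "0 \<le> x - of_int m / real q" "x - of_int m / real q < 1 / real q"
      by (simp_all add: add_divide_distrib)
  qed
  finally show ?thesis by (simp add: g_def)
qed

lemma saw_sum_rational_rotation:
  fixes p :: int
  assumes q: "q > 0" and cop: "coprime p (int q)"
  shows "(\<Sum>j=1..q. saw (x + real j * (of_int p / real q))) = saw (real q * x)"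
proof -
  define f where "f j = nat ((int j * p) mod int q)" for j
  have inj: "inj_on f {1..q}"
  proof (rule inj_onI)
    fix i j assume ij: "i \<in> {1..q}" "j \<in> {1..q}" "f i = f j"
    then have "(int i * p) mod int q = (int j * p) mod int q"
      using q by (simp add: f_def nat_eq_iff)
    then have "int q dvd (int i - int j) * p"
      by (simp add: mod_eq_dvd_iff left_diff_distrib)
    then have "int q dvd int i - int j"
      using cop by (simp add: coprime_commute coprime_dvd_mult_left_iff)
    moreover have "\<bar>int i - int j\<bar> < int q" using ij by auto
    ultimately have "int i - int j = 0" using zdvd_imp_le[of "int q" "\<bar>int i - int j\<bar>"] by fastforce
    then show "i = j" by simp
  qed
  have sub: "f ` {1..q} \<subseteq> {..<q}" using q by (auto simp: f_def nat_less_iff)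
  have img: "f ` {1..q} = {..<q}"
    using sub inj by (intro card_subset_eq) (auto simp: card_image)
  have "(\<Sum>j=1..q. saw (x + real j * (of_int p / real q))) = (\<Sum>j=1..q. saw (x + real (f j) / real q))"
  proof (rule sum.cong[OF refl])
    fix j
    have "int j * p = int (f j) + int q * ((int j * p) div int q)"
      using q by (simp add: f_def)
    then have "real j * of_int p = real (f j) + real q * of_int ((int j * p) div int q)"
      by (metis of_int_add of_int_mult of_int_of_nat_eq)
    then have "real j * (of_int p / real q) = real (f j) / real q + of_int ((int j * p) div int q)"
      using q by (simp add: field_simps)
    then show "saw (x + real j * (of_int p / real q)) = saw (x + real (f j) / real q)"
      using saw_periodic[of "x + real (f j) / real q"] by (simp add: add.assoc)
  qed
  also have "\<dots> = (\<Sum>r\<in>f ` {1..q}. saw (x + real r / real q))"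
    using inj by (simp add: sum.reindex)
  also have "\<dots> = saw (real q * x)" unfolding img by (rule saw_multiplication[OF q])
  finally show ?thesis .
qed

definition corr :: "real \<Rightarrow> real" where
  "corr c = (\<integral>x. saw x * saw (x + c) \<partial>circ)"

lemma integral_saw_saw: "(\<integral>x. saw (x + a) * saw (x + b) \<partial>circ) = corr (b - a)"
  using integral_circ_translate[OF circle_fun_mult[OF circle_fun_saw circle_fun_shift[OF circle_fun_saw, of "b - a"]], of a]
  by (simp add: corr_def add.assoc)

lemma corr_minus: "corr (- c) = corr c"
  using integral_saw_saw[of c 0] by (simp add: corr_def mult.commute)

lemma corr_0: "corr 0 = 1/12"
  by (simp add: corr_def integral_saw_powers)

lemma corr_diff_le: "\<bar>corr (c + d) - corr c\<bar> \<le> \<bar>d\<bar>"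
proof -
  note cf = circle_fun_mult[OF circle_fun_saw circle_fun_shift[OF circle_fun_saw]]
  have "corr (c + d) - corr c = (\<integral>x. saw x * saw (x + (c + d)) - saw x * saw (x + c) \<partial>circ)"
    unfolding corr_def by (rule Bochner_Integration.integral_diff[symmetric]) (rule integrable_circle_fun[OF cf])+
  also have "\<bar>\<dots>\<bar> \<le> (\<integral>x. 1/2 * \<bar>saw (x + (c + d)) - saw (x + c)\<bar> \<partial>circ)"
    unfolding real_norm_def[symmetric]
  proof (rule Bochner_Integration.integral_norm_bound_integral)
    show "integrable circ (\<lambda>x. saw x * saw (x + (c + d)) - saw x * saw (x + c))"
      by (intro Bochner_Integration.integrable_diff integrable_circle_fun[OF cf])
    have "integrable circ (\<lambda>x. norm (saw (x + (c + d)) - saw (x + c)))"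
      by (intro integrable_norm Bochner_Integration.integrable_diff integrable_circle_fun[OF circle_fun_shift[OF circle_fun_saw]])
    then show "integrable circ (\<lambda>x. 1/2 * norm (saw (x + (c + d)) - saw (x + c)))" by simp
    show "norm (saw x * saw (x + (c + d)) - saw x * saw (x + c)) \<le> 1/2 * norm (saw (x + (c + d)) - saw (x + c))" for x
      unfolding right_diff_distrib[symmetric] norm_mult
      using abs_saw_le[of x] by (intro mult_right_mono) auto
  qed
  also have "\<dots> = 1/2 * (\<integral>x. \<bar>saw (x + (c + d)) - saw (x + c)\<bar> \<partial>circ)" by simp
  also have "\<dots> \<le> 1/2 * (2 * \<bar>(c + d) - c\<bar>)"
    using L1_shift[OF circle_fun_saw L1_lip_saw, of "c + d" c] by (intro mult_left_mono) auto
  finally show ?thesis by simp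
qed

lemma circle_fun_corr: "circle_fun 1 corr"
proof (rule circle_funI)
  have "continuous_on UNIV corr"
  proof (rule lipschitz_on_continuous_on[where L=1], rule lipschitz_onI)
    show "dist (corr x) (corr y) \<le> 1 * dist x y" for x y
      using corr_diff_le[of y "x - y"] by (simp add: dist_real_def)
  qed simp
  then show "corr \<in> borel_measurable borel" by (rule borel_measurable_continuous_onI)
  show "corr (x + 1) = corr x" for x
    using saw_periodic[of "_ + x" 1] by (simp add: corr_def add.assoc)
  have "norm (corr c) \<le> 1/2 * (1/2)" for c unfolding corr_def
    by (rule norm_integral_circle_fun_le[OF circle_fun_mult[OF circle_fun_saw circle_fun_shift[OF circle_fun_saw]]])
  then show "norm (corr c) \<le> 1" for c by (rule order_trans) simp
qed

lemma L1_lip_corr: "L1_lip 1 corr"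
  unfolding L1_lip_def
proof
  fix d :: real
  have "(\<integral>x. norm (corr (x + d) - corr x) \<partial>circ) \<le> \<bar>d\<bar>"
    by (rule circ.integral_le_const)
       (use corr_diff_le in \<open>auto intro!: integrable_norm Bochner_Integration.integrable_diff integrable_circle_fun[OF circle_fun_shift[OF circle_fun_corr]] integrable_circle_fun[OF circle_fun_corr]\<close>)
  then show "(\<integral>x. norm (corr (x + d) - corr x) \<partial>circ) \<le> 1 * \<bar>d\<bar>" by simp
qed

lemma integral_corr: "(\<integral>c. corr c \<partial>circ) = 0"
  unfolding corr_def
  using circle_fubini[OF circle_fun_saw circle_fun_saw, where q=1] by (simp add: integral_saw_powers)

section \<open>Continued fraction denominators\<close>

lemma irrational_frac: "x \<notin> \<rat> \<Longrightarrow> frac x \<notin> \<rat>"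
proof
  assume x: "x \<notin> \<rat>" "frac x \<in> \<rat>"
  then have "frac x + of_int \<lfloor>x\<rfloor> \<in> \<rat>" by (intro Rats_add Rats_of_int)
  then show False using x by (simp add: frac_def)
qed

lemma complete_quotient_irrational:
  assumes "\<alpha> \<notin> \<rat>" shows "complete_quotient \<alpha> n \<notin> \<rat>"
proof (induction n)
  case (Suc n)
  then have "frac (complete_quotient \<alpha> n) \<notin> \<rat>" by (rule irrational_frac)
  then show ?case using Rats_inverse[of "1 / frac (complete_quotient \<alpha> n)"] by (auto simp: divide_inverse)
qed (use assms in simp)

lemma frac_complete_quotient_pos:
  assumes "\<alpha> \<notin> \<rat>" shows "frac (complete_quotient \<alpha> n) > 0"
  using complete_quotient_irrational[OF assms, of n] Ints_subset_Rats by auto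

lemma complete_quotient_gt_1:
  assumes "\<alpha> \<notin> \<rat>" shows "complete_quotient \<alpha> (Suc n) > 1"
  using frac_complete_quotient_pos[OF assms, of n] frac_lt_1[of "complete_quotient \<alpha> n"] by simp

lemma partial_quotient_Suc:
  assumes "\<alpha> \<notin> \<rat>"
  shows "partial_quotient \<alpha> (Suc n) \<ge> 1"
    "real (partial_quotient \<alpha> (Suc n)) = complete_quotient \<alpha> (Suc n) - frac (complete_quotient \<alpha> (Suc n))"
proof -
  have *: "1 \<le> \<lfloor>complete_quotient \<alpha> (Suc n)\<rfloor>"
    using complete_quotient_gt_1[OF assms, of n] by linarith
  show "partial_quotient \<alpha> (Suc n) \<ge> 1"
    using nat_mono[OF *] by (simp only: partial_quotient_def nat_one_as_int)
  show "real (partial_quotient \<alpha> (Suc n)) = complete_quotient \<alpha> (Suc n) - frac (complete_quotient \<alpha> (Suc n))"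
    using * unfolding partial_quotient_def frac_def by (simp del: complete_quotient.simps)
qed

text \<open>
  This is the distance \<open>|q\<^sub>n \<alpha> - p\<^sub>n|\<close> of the \<open>n\<close>-th convergent.  The product form makes
  positivity evident, and the recursion \<open>cf_err_rec\<close> is that of the denominators with alternating signs.
\<close>
definition cf_err :: "real \<Rightarrow> nat \<Rightarrow> real" where
  "cf_err \<alpha> n = (\<Prod>i\<le>n. frac (complete_quotient \<alpha> i))"

lemma cf_err_pos: "\<alpha> \<notin> \<rat> \<Longrightarrow> cf_err \<alpha> n > 0"
  unfolding cf_err_def by (intro prod_pos frac_complete_quotient_pos)

lemma cf_err_rec:
  assumes "\<alpha> \<notin> \<rat>"
  shows "cf_err \<alpha> (Suc (Suc n)) = cf_err \<alpha> n - real (partial_quotient \<alpha> (Suc (Suc n))) * cf_err \<alpha> (Suc n)"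
proof -
  have "cf_err \<alpha> n = cf_err \<alpha> (Suc n) * complete_quotient \<alpha> (Suc (Suc n))"
    using frac_complete_quotient_pos[OF assms, of "Suc n"] by (simp add: cf_err_def)
  moreover have "cf_err \<alpha> (Suc (Suc n)) = cf_err \<alpha> (Suc n) * frac (complete_quotient \<alpha> (Suc (Suc n)))"
    by (simp add: cf_err_def)
  ultimately show ?thesis
    unfolding partial_quotient_Suc(2)[OF assms] by (simp only: algebra_simps)
qed

lemma cf_denom_err:
  assumes "\<alpha> \<in> {0<..<1}" "\<alpha> \<notin> \<rat>"
  shows "real (cf_denom \<alpha> (Suc n)) * cf_err \<alpha> n + real (cf_denom \<alpha> n) * cf_err \<alpha> (Suc n) = 1"
proof (induction n)
  case 0
  have a: "frac \<alpha> = \<alpha>" using assms(1) by (simp add: frac_eq)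
  show ?case using partial_quotient_Suc(2)[OF assms(2), of 0] assms(1)
    by (simp add: cf_err_def a field_simps)
next
  case (Suc n)
  then show ?case unfolding cf_err_rec[OF assms(2)] by (simp add: algebra_simps)
qed

lemma cf_denom_pos: "\<alpha> \<notin> \<rat> \<Longrightarrow> cf_denom \<alpha> n > 0"
proof (induction n rule: less_induct)
  case (less n)
  show ?case
  proof (cases n)
    case (Suc m)
    show ?thesis
    proof (cases m)
      case 0 then show ?thesis using Suc partial_quotient_Suc(1)[OF less.prems, of 0] by auto
    next
      case (Suc k) then show ?thesis using \<open>n = Suc m\<close> less.IH[of k] less.prems by simp
    qed
  qed simp
qed

lemma cf_denom_Suc_ge:
  assumes "\<alpha> \<notin> \<rat>"
  shows "cf_denom \<alpha> (Suc n) \<ge> partial_quotient \<alpha> (Suc n) * cf_denom \<alpha> n"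
  by (cases n) auto

lemma cf_denom_ge: "\<alpha> \<notin> \<rat> \<Longrightarrow> cf_denom \<alpha> (Suc n) > n"
proof (induction n)
  case 0 then show ?case using cf_denom_pos[of \<alpha> "Suc 0"] by blast
next
  case (Suc n)
  have "cf_denom \<alpha> (Suc (Suc n)) \<ge> 1 * cf_denom \<alpha> (Suc n) + cf_denom \<alpha> n"
    using partial_quotient_Suc(1)[OF Suc.prems, of "Suc n"]
    by (simp only: cf_denom.simps) (intro add_mono mult_right_mono; simp)
  moreover have "cf_denom \<alpha> (Suc n) > n" using Suc by blast
  ultimately show ?case using cf_denom_pos[OF Suc.prems, of n] by linarith
qed

lemma cf_numer_exists:
  assumes "\<alpha> \<in> {0<..<1}" "\<alpha> \<notin> \<rat>"
  shows "\<exists>p::int. real (cf_denom \<alpha> n) * \<alpha> - of_int p = (-1) ^ n * cf_err \<alpha> n"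
proof (induction n rule: less_induct)
  case (less n)
  have a: "frac \<alpha> = \<alpha>" using assms(1) by (simp add: frac_eq)
  consider "n = 0" | "n = 1" | k where "n = Suc (Suc k)"
    by (metis One_nat_def not0_implies_Suc)
  then show ?case
  proof cases
    case 1 then show ?thesis by (intro exI[of _ 0]) (simp add: cf_err_def a)
  next
    case 2
    then show ?thesis using partial_quotient_Suc(2)[OF assms(2), of 0] assms(1)
      by (intro exI[of _ 1]) (simp add: cf_err_def a field_simps)
  next
    case 3
    obtain p p' :: int where
      "real (cf_denom \<alpha> k) * \<alpha> - of_int p = (-1) ^ k * cf_err \<alpha> k"
      "real (cf_denom \<alpha> (Suc k)) * \<alpha> - of_int p' = (-1) ^ Suc k * cf_err \<alpha> (Suc k)"
      using less[of k] less[of "Suc k"] 3 by auto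
    note pp' = this
    have "real (cf_denom \<alpha> n) * \<alpha> - of_int (int (partial_quotient \<alpha> n) * p' + p)
        = real (partial_quotient \<alpha> n) * (real (cf_denom \<alpha> (Suc k)) * \<alpha> - of_int p')
          + (real (cf_denom \<alpha> k) * \<alpha> - of_int p)"
      unfolding 3 by (simp add: algebra_simps)
    also have "\<dots> = (-1) ^ n * cf_err \<alpha> n"
      unfolding pp' unfolding 3 cf_err_rec[OF assms(2)] by (simp add: algebra_simps)
    finally have "real (cf_denom \<alpha> n) * \<alpha> - of_int (int (partial_quotient \<alpha> n) * p' + p) = (-1) ^ n * cf_err \<alpha> n" .
    then show ?thesis by blast
  qed
qed

text \<open>
  The identity \<open>cf_denom_err\<close> does two jobs: dropping its second summand bounds the error, and
  rewriting the errors through the numerators turns it into \<open>q p' - q' p = \<plusminus>1\<close>, which gives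
  coprimality.
\<close>
lemma cf_rational_approximation:
  assumes "\<alpha> \<in> {0<..<1}" "\<alpha> \<notin> \<rat>"
  obtains p :: int where "coprime p (int (cf_denom \<alpha> n))"
    "\<bar>real (cf_denom \<alpha> n) * \<alpha> - of_int p\<bar> \<le> 1 / real (cf_denom \<alpha> (Suc n))"
proof -
  obtain p p' :: int where
    p: "real (cf_denom \<alpha> n) * \<alpha> - of_int p = (-1) ^ n * cf_err \<alpha> n" and
    p': "real (cf_denom \<alpha> (Suc n)) * \<alpha> - of_int p' = (-1) ^ Suc n * cf_err \<alpha> (Suc n)"
    using cf_numer_exists[OF assms] by blast
  let ?q = "cf_denom \<alpha> n" and ?q' = "cf_denom \<alpha> (Suc n)"
  have "real_of_int (int ?q * p' - int ?q' * p) = real ?q' * (real ?q * \<alpha> - of_int p) - real ?q * (real ?q' * \<alpha> - of_int p')"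
    by (simp add: algebra_simps)
  also have "\<dots> = (-1) ^ n * (real ?q' * cf_err \<alpha> n + real ?q * cf_err \<alpha> (Suc n))"
    unfolding p p' by (simp add: algebra_simps)
  also have "\<dots> = of_int ((-1) ^ n)" by (simp add: cf_denom_err[OF assms])
  finally have det: "int ?q * p' - int ?q' * p = (-1) ^ n" by linarith
  have "coprime p (int ?q)"
  proof (rule coprimeI)
    fix c assume "c dvd p" "c dvd int ?q"
    then have "c dvd int ?q * p' - int ?q' * p" by auto
    then have "c dvd (-1) ^ n" by (simp add: det)
    then show "is_unit c" by (cases "even n") auto
  qed
  moreover have "\<bar>real ?q * \<alpha> - of_int p\<bar> \<le> 1 / real ?q'"
  proof -
    have "real ?q' * cf_err \<alpha> n \<le> 1"
      using cf_denom_err[OF assms, of n] cf_err_pos[OF assms(2), of "Suc n"]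
      by (smt (verit) mult_nonneg_nonneg of_nat_0_le_iff)
    then show ?thesis unfolding p using cf_err_pos[OF assms(2), of n] cf_denom_pos[OF assms(2), of "Suc n"]
      by (simp add: abs_mult power_abs field_simps)
  qed
  ultimately show ?thesis using that by blast
qed

lemma unbounded_partial_quotients:
  assumes "\<not> bounded_type \<alpha>"
  shows "\<exists>n>m. partial_quotient \<alpha> (Suc n) \<ge> C"
proof (rule ccontr)
  assume "\<not> ?thesis"
  then have *: "partial_quotient \<alpha> (Suc n) < C" if "n > m" for n using that by force
  have "partial_quotient \<alpha> n \<le> C + (\<Sum>i\<le>Suc m. partial_quotient \<alpha> i)" if "n \<ge> 1" for n
  proof (cases "n \<le> Suc m")
    case True
    then have "partial_quotient \<alpha> n \<le> (\<Sum>i\<le>Suc m. partial_quotient \<alpha> i)"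
      by (intro member_le_sum) auto
    then show ?thesis by simp
  next
    case False
    then have "m < n - 1" "Suc (n - 1) = n" by linarith+
    then show ?thesis using *[of "n - 1"] by simp
  qed
  then have "bounded_type \<alpha>" unfolding bounded_type_def by (intro bdd_aboveI2) auto
  with assms show False by simp
qed

text \<open>
  A recursive choice: each index is taken so far out that its denominator dominates the sum of the
  earlier ones, at a place where the next partial quotient is large.
\<close>
lemma sparse_denominators:
  assumes "\<alpha> \<notin> \<rat>" "\<not> bounded_type \<alpha>"
  obtains u where "strict_mono u"
    "\<And>k. partial_quotient \<alpha> (Suc (u k)) \<ge> 2 ^ k"
    "\<And>k. (\<Sum>j<k. cf_denom \<alpha> (u j)) * 2 ^ k \<le> cf_denom \<alpha> (u k)"
proof -
  have step: "\<exists>n. n > m \<and> partial_quotient \<alpha> (Suc n) \<ge> C \<and> L \<le> cf_denom \<alpha> n" for m C L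
  proof -
    obtain n where n: "n > max m (Suc L)" "partial_quotient \<alpha> (Suc n) \<ge> C"
      using unbounded_partial_quotients[OF assms(2)] by blast
    then have "cf_denom \<alpha> n > n - 1" using cf_denom_ge[OF assms(1), of "n - 1"] by simp
    then show ?thesis using n by (intro exI[of _ n]) auto
  qed
  have "\<exists>s::nat \<Rightarrow> nat \<times> nat. \<forall>k. ((k = 0 \<longrightarrow> snd (s k) = 0)) \<and> (fst (s k) < fst (s (Suc k)) \<and>
    snd (s (Suc k)) = snd (s k) + cf_denom \<alpha> (fst (s (Suc k))) \<and>
    partial_quotient \<alpha> (Suc (fst (s (Suc k)))) \<ge> 2 ^ k \<and>
    snd (s k) * 2 ^ k \<le> cf_denom \<alpha> (fst (s (Suc k))))"
  \<comment> \<open>The second component of the state accumulates the denominators chosen so far\<close>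
  proof (rule dependent_nat_choice)
    show "\<exists>x::nat\<times>nat. (0::nat) = 0 \<longrightarrow> snd x = 0" by auto
    fix x :: "nat \<times> nat" and k :: nat
    obtain n where "n > fst x \<and> partial_quotient \<alpha> (Suc n) \<ge> 2 ^ k \<and> snd x * 2 ^ k \<le> cf_denom \<alpha> n"
      using step by blast
    then show "\<exists>y. (Suc k = 0 \<longrightarrow> snd y = 0) \<and> fst x < fst y \<and>
      snd y = snd x + cf_denom \<alpha> (fst y) \<and> 2 ^ k \<le> partial_quotient \<alpha> (Suc (fst y)) \<and>
      snd x * 2 ^ k \<le> cf_denom \<alpha> (fst y)"
      by (intro exI[of _ "(n, snd x + cf_denom \<alpha> n)"]) auto
  qed
  then obtain s :: "nat \<Rightarrow> nat \<times> nat" where s: "\<And>k. fst (s k) < fst (s (Suc k))"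
      "\<And>k. snd (s (Suc k)) = snd (s k) + cf_denom \<alpha> (fst (s (Suc k)))"
      "\<And>k. partial_quotient \<alpha> (Suc (fst (s (Suc k)))) \<ge> 2 ^ k"
      "\<And>k. snd (s k) * 2 ^ k \<le> cf_denom \<alpha> (fst (s (Suc k)))" "snd (s 0) = 0"
    by metis
  have sum: "snd (s k) = (\<Sum>j<k. cf_denom \<alpha> (fst (s (Suc j))))" for k
    by (induction k) (use s in auto)
  show ?thesis
  proof (rule that[of "\<lambda>k. fst (s (Suc k))"])
    show "strict_mono (\<lambda>k. fst (s (Suc k)))" using s(1) by (intro strict_monoI_Suc) auto
    show "2 ^ k \<le> partial_quotient \<alpha> (Suc (fst (s (Suc k))))" for k by (rule s)
    show "(\<Sum>j<k. cf_denom \<alpha> (fst (s (Suc j)))) * 2 ^ k \<le> cf_denom \<alpha> (fst (s (Suc k)))" for k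
      using s(4)[of k] by (simp add: sum)
  qed
qed

section \<open>A law of large numbers along lacunary dilations\<close>

text \<open>
  Decoupling the \<open>k\<close>-th dilation from its predecessors costs the sum of these divided by \<open>q k\<close>; the
  factor \<open>2 ^ k\<close> makes the total cost over all \<open>k\<close> finite.
\<close>
definition lacunary :: "(nat \<Rightarrow> nat) \<Rightarrow> bool" where
  "lacunary q \<longleftrightarrow> (\<forall>k. 0 < q k \<and> (\<Sum>j<k. q j) * 2 ^ k \<le> q k)"

lemma lacunaryD:
  assumes "lacunary q"
  shows "0 < q k" "(\<Sum>j<k. real (q j)) / real (q k) \<le> (1/2) ^ k"
proof -
  show q: "0 < q k" using assms by (simp add: lacunary_def)
  have "(\<Sum>j<k. q j) * 2 ^ k \<le> q k" using assms by (simp add: lacunary_def)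
  then have "real ((\<Sum>j<k. q j) * 2 ^ k) \<le> real (q k)" by (rule of_nat_mono)
  then show "(\<Sum>j<k. real (q j)) / real (q k) \<le> (1/2) ^ k"
    using q by (simp add: field_simps power_divide)
qed

text \<open>
  Induction on \<open>N\<close>: the cross term of the new summand with the preceding sum is bounded by decoupling,
  so the second moment grows linearly, as for independent summands.
\<close>
lemma second_moment_lacunary:
  fixes f :: "real \<Rightarrow> real"
  assumes f: "circle_fun B f" "L1_lip M f" "(\<integral>x. f x \<partial>circ) = 0" and q: "lacunary q" and M: "M \<ge> 0"
  shows "(\<integral>x. (\<Sum>k<N. f (real (q k) * x))\<^sup>2 \<partial>circ) \<le> real N * (2 * B * M + B * B)"
proof (induction N)
  case 0 then show ?case by simp
next
  case (Suc N)
  let ?S = "\<lambda>x. \<Sum>k<N. f (real (q k) * x)" and ?g = "\<lambda>x. f (real (q N) * x)"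
  have B: "0 \<le> B" using circle_funD(4)[OF f(1)] .
  have g: "circle_fun B (\<lambda>x. f (real (q k) * x))" for k using circle_fun_scale[OF f(1), of "q k" 0] by simp
  have S: "circle_fun (\<Sum>k<N. B) ?S" by (intro circle_fun_sum g) simp
  have SL: "L1_lip (\<Sum>k<N. M * real (q k)) ?S"
    by (rule L1_lip_sum[OF _ g]) (auto intro!: L1_lip_scale[OF f(1,2)] lacunaryD(1)[OF q])
  have "norm ((\<integral>x. ?S x * ?g x \<partial>circ) - (\<integral>x. ?S x \<partial>circ) * (\<integral>x. f x \<partial>circ)) \<le> B * (\<Sum>k<N. M * real (q k)) / real (q N)"
    by (rule circle_decouple[OF S SL f(1) lacunaryD(1)[OF q]])
  also have "\<dots> = B * M * ((\<Sum>k<N. real (q k)) / real (q N))"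
    by (simp add: sum_distrib_left mult.assoc)
  also have "\<dots> \<le> B * M * (1/2) ^ N"
    using B M lacunaryD(2)[OF q] by (intro mult_left_mono) auto
  also have "\<dots> \<le> B * M * 1"
    using B M by (intro mult_left_mono power_le_one) auto
  finally have cross: "(\<integral>x. ?S x * ?g x \<partial>circ) \<le> B * M" by (simp add: f(3))
  have sq: "(\<integral>x. ?g x * ?g x \<partial>circ) \<le> B * B"
    using norm_integral_circle_fun_le[OF circle_fun_mult[OF g[of N] g[of N]]] by simp
  have "(\<integral>x. (\<Sum>k<Suc N. f (real (q k) * x))\<^sup>2 \<partial>circ) = (\<integral>x. (?S x)\<^sup>2 + 2 * (?S x * ?g x) + ?g x * ?g x \<partial>circ)"
    by (intro Bochner_Integration.integral_cong) (auto simp: power2_eq_square algebra_simps)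
  also have "\<dots> = (\<integral>x. (?S x)\<^sup>2 \<partial>circ) + 2 * (\<integral>x. ?S x * ?g x \<partial>circ) + (\<integral>x. ?g x * ?g x \<partial>circ)"
    using integrable_circle_fun[OF circle_fun_mult[OF S S]] integrable_circle_fun[OF circle_fun_mult[OF S g[of N]]]
      integrable_circle_fun[OF circle_fun_mult[OF g[of N] g[of N]]]
    by (simp add: power2_eq_square)
  also have "\<dots> \<le> real N * (2 * B * M + B * B) + 2 * (B * M) + B * B"
    using Suc cross sq by (intro add_mono mult_left_mono) auto
  finally show ?case by (simp add: algebra_simps)
qed

text \<open>
  Between consecutive squares \<open>r\<^sup>2\<close> and \<open>(r + 1)\<^sup>2\<close> the partial sums vary by at most \<open>2 r B\<close>,
  which is negligible compared with \<open>r\<^sup>2\<close>.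
\<close>
lemma averages_via_squares:
  fixes a :: "nat \<Rightarrow> real"
  assumes a: "\<And>k. \<bar>a k\<bar> \<le> B" and lim: "(\<lambda>n. (\<Sum>k<(Suc n)\<^sup>2. a k) / real ((Suc n)\<^sup>2)) \<longlonglongrightarrow> 0"
  shows "(\<lambda>N. (\<Sum>k<N. a k) / real N) \<longlonglongrightarrow> 0"
proof -
  define S where "S N = (\<Sum>k<N. a k)" for N
  define r where "r N = floor_sqrt N" for N
  have B: "0 \<le> B" using a[of 0] by linarith
  have Sdiff: "\<bar>S N - S m\<bar> \<le> B * real (N - m)" if "m \<le> N" for m N
  proof -
    have "S N - S m = (\<Sum>k=m..<N. a k)"
      using that by (simp add: S_def lessThan_atLeast0 sum_diff_nat_ivl)
    also have "\<bar>\<dots>\<bar> \<le> (\<Sum>k=m..<N. \<bar>a k\<bar>)" by (rule sum_abs)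
    also have "\<dots> \<le> (\<Sum>k=m..<N. B)" by (intro sum_mono a)
    finally show ?thesis by (simp add: mult.commute)
  qed
  have r1: "(r N)\<^sup>2 \<le> N" "N < (Suc (r N))\<^sup>2" for N
    using floor_sqrt_power2_le[of N] Suc_floor_sqrt_power2_gt[of N] by (auto simp: r_def)
  have rpos: "r N > 0" if "N > 0" for N using r1(2)[of N] that by (cases "r N") auto
  have rtop: "filterlim r at_top sequentially"
  proof (unfold filterlim_at_top, intro allI)
    fix Z
    show "\<forall>\<^sub>F N in sequentially. Z \<le> r N"
      using eventually_ge_at_top[of "Z\<^sup>2"]
    proof eventually_elim
      case (elim N)
      then have "Z\<^sup>2 < (Suc (r N))\<^sup>2" using r1(2)[of N] by linarith
      then have "Z < Suc (r N)" by (rule power_less_imp_less_base) simp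
      then show ?case by simp
    qed
  qed
  have lim': "(\<lambda>n. S (n\<^sup>2) / real (n\<^sup>2)) \<longlonglongrightarrow> 0"
    using lim unfolding S_def by (subst filterlim_sequentially_Suc[symmetric])
  have l1: "(\<lambda>N. \<bar>S ((r N)\<^sup>2) / real ((r N)\<^sup>2)\<bar>) \<longlonglongrightarrow> 0"
    using filterlim_compose[OF lim' rtop] by (rule tendsto_rabs_zero)
  have "(\<lambda>n. 2 * B / real n) \<longlonglongrightarrow> 0"
    by (rule lim_const_over_n)
  then have l2: "(\<lambda>N. 2 * B / real (r N)) \<longlonglongrightarrow> 0"
    by (rule filterlim_compose[OF _ rtop])
  have l3: "(\<lambda>N. \<bar>S ((r N)\<^sup>2) / real ((r N)\<^sup>2)\<bar> + 2 * B / real (r N)) \<longlonglongrightarrow> 0"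
    using tendsto_add[OF l1 l2] by simp
  have "(\<lambda>N. S N / real N) \<longlonglongrightarrow> 0"
  proof (rule Lim_null_comparison[OF _ l3])
    show "\<forall>\<^sub>F N in sequentially. norm (S N / real N) \<le> \<bar>S ((r N)\<^sup>2) / real ((r N)\<^sup>2)\<bar> + 2 * B / real (r N)"
      using eventually_gt_at_top[of 0]
    proof eventually_elim
      case (elim N)
      let ?r = "r N"
      have rp: "0 < ?r" using rpos[OF elim] .
      have "\<bar>S N\<bar> \<le> \<bar>S (?r\<^sup>2)\<bar> + B * real (N - ?r\<^sup>2)"
        using Sdiff[OF r1(1)[of N]] by linarith
      also have "\<dots> \<le> \<bar>S (?r\<^sup>2)\<bar> + B * (2 * real ?r)"
      proof -
        have "N - ?r\<^sup>2 \<le> 2 * ?r" using r1(2)[of N] by (simp add: power2_eq_square)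
        then have "real (N - ?r\<^sup>2) \<le> 2 * real ?r" by linarith
        then show ?thesis using B by (intro add_mono mult_left_mono) auto
      qed
      finally have "\<bar>S N\<bar> \<le> \<bar>S (?r\<^sup>2)\<bar> + B * (2 * real ?r)" .
      then have "\<bar>S N\<bar> / real N \<le> (\<bar>S (?r\<^sup>2)\<bar> + B * (2 * real ?r)) / real N"
        by (intro divide_right_mono) auto
      also have "\<dots> \<le> (\<bar>S (?r\<^sup>2)\<bar> + B * (2 * real ?r)) / real (?r\<^sup>2)"
        using r1(1)[of N] rp elim B by (intro divide_left_mono) auto
      also have "\<dots> = \<bar>S (?r\<^sup>2) / real (?r\<^sup>2)\<bar> + 2 * B / real ?r"
        using rp by (simp add: add_divide_distrib power2_eq_square abs_divide abs_mult)
      finally show ?case by simp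
    qed
  qed
  then show ?thesis by (simp add: S_def)
qed

text \<open>
  Along squares the second moments of the averages are summable, so the averages tend to 0 almost
  everywhere there; \<open>averages_via_squares\<close> fills the gaps.
\<close>
lemma LLN_lacunary_circ:
  fixes f :: "real \<Rightarrow> real"
  assumes f: "circle_fun B f" "L1_lip M f" "(\<integral>x. f x \<partial>circ) = 0" and q: "lacunary q" and M: "M \<ge> 0"
  shows "AE x in circ. (\<lambda>N. (\<Sum>k<N. f (real (q k) * x)) / real N) \<longlonglongrightarrow> 0"
proof -
  define C where "C = 2 * B * M + B * B"
  define Y where "Y n x = ((\<Sum>k<(Suc n)\<^sup>2. f (real (q k) * x)) / real ((Suc n)\<^sup>2))\<^sup>2" for n x
  have B: "0 \<le> B" using circle_funD(4)[OF f(1)] .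
  have C: "0 \<le> C" using B M by (simp add: C_def)
  have g: "circle_fun B (\<lambda>x. f (real (q k) * x))" for k using circle_fun_scale[OF f(1), of "q k" 0] by simp
  have S: "circle_fun (\<Sum>k<N. B) (\<lambda>x. \<Sum>k<N. f (real (q k) * x))" for N by (intro circle_fun_sum g) simp
  have Ymeas[measurable]: "Y n \<in> borel_measurable circ" for n
    unfolding Y_def
    by (intro measurable_circI borel_measurable_power borel_measurable_divide borel_measurable_const circle_funD(1)[OF S])
  have Yint: "integrable circ (Y n)" for n
    using integrable_circle_fun[OF circle_fun_mult[OF S S], of "(Suc n)\<^sup>2"]
    unfolding Y_def power_divide power2_eq_square[of "sum _ _"] by simp
  have EY: "(\<integral>x. Y n x \<partial>circ) \<le> C * (1 / (real (Suc n))\<^sup>2)" for n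
  proof -
    have "(\<integral>x. Y n x \<partial>circ) = (\<integral>x. (\<Sum>k<(Suc n)\<^sup>2. f (real (q k) * x))\<^sup>2 \<partial>circ) / (real ((Suc n)\<^sup>2))\<^sup>2"
      by (simp add: Y_def power_divide)
    also have "\<dots> \<le> real ((Suc n)\<^sup>2) * C / (real ((Suc n)\<^sup>2))\<^sup>2"
      unfolding C_def by (intro divide_right_mono second_moment_lacunary[OF f q M]) simp
    also have "\<dots> = C * (1 / (real (Suc n))\<^sup>2)"
    proof -
      have "real (m\<^sup>2) * C / (real (m\<^sup>2))\<^sup>2 = C * (1 / (real m)\<^sup>2)" for m
        by (simp add: power2_eq_square)
      then show ?thesis .
    qed
    finally show ?thesis .
  qed
  have sm: "summable (\<lambda>n. C * (1 / (real (Suc n))\<^sup>2))"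
  proof (rule summable_mult)
    show "summable (\<lambda>n. 1 / (real (Suc n))\<^sup>2)"
      using summable_Suc_iff[of "\<lambda>n. inverse ((real n)\<^sup>2)"] inverse_power_summable[of 2, where 'a=real]
      by (simp add: inverse_eq_divide del: of_nat_Suc)
  qed
  have "(\<integral>\<^sup>+x. (\<Sum>n. ennreal (Y n x)) \<partial>circ) = (\<Sum>n. \<integral>\<^sup>+x. ennreal (Y n x) \<partial>circ)"
    by (rule nn_integral_suminf) measurable
  also have "\<dots> = (\<Sum>n. ennreal (\<integral>x. Y n x \<partial>circ))"
    by (intro suminf_cong nn_integral_eq_integral Yint) (simp add: Y_def)
  also have "\<dots> \<le> (\<Sum>n. ennreal (C * (1 / (real (Suc n))\<^sup>2)))"
    by (intro suminf_le ennreal_leI EY) auto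
  also have "\<dots> = ennreal (\<Sum>n. C * (1 / (real (Suc n))\<^sup>2))"
    by (rule suminf_ennreal2[OF _ sm]) (use C in auto)
  also have "\<dots> < \<infinity>" by simp
  finally have "(\<integral>\<^sup>+x. (\<Sum>n. ennreal (Y n x)) \<partial>circ) \<noteq> \<infinity>" by simp
  then have "AE x in circ. (\<Sum>n. ennreal (Y n x)) \<noteq> \<infinity>"
    by (rule nn_integral_noteq_infinite[rotated]) measurable
  then show ?thesis
  proof eventually_elim
    case (elim x)
    have "summable (\<lambda>n. Y n x)"
      by (rule summable_suminf_not_top) (use elim in \<open>auto simp: Y_def\<close>)
    then have "(\<lambda>n. Y n x) \<longlonglongrightarrow> 0" by (rule summable_LIMSEQ_zero)
    then have "(\<lambda>n. (\<Sum>k<(Suc n)\<^sup>2. f (real (q k) * x)) / real ((Suc n)\<^sup>2)) \<longlonglongrightarrow> 0"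
      using tendsto_real_sqrt[of "\<lambda>n. Y n x" 0] unfolding Y_def real_sqrt_abs by (simp add: tendsto_rabs_zero_iff)
    then show ?case
      by (rule averages_via_squares[rotated]) (use circle_funD(3)[OF f(1)] in simp)
  qed
qed

text \<open>
  Needed because the law of large numbers is evaluated at \<open>\<beta> - \<gamma>\<close> and \<open>\<beta> + \<gamma>\<close>, which may leave the
  unit interval.
\<close>
lemma AE_circ_imp_AE_lborel:
  assumes P: "AE x in circ. P x" and per: "\<And>x. P (x + 1) \<longleftrightarrow> P x"
  shows "AE x in lborel. P x"
proof -
  have "AE x in lborel. x \<in> {0..<1} \<longrightarrow> P x"
    using P unfolding circ_def by (subst (asm) AE_restrict_space_iff) auto
  then obtain N where N: "N \<in> null_sets lborel" "{x. \<not> (x \<in> {0..<1} \<longrightarrow> P x)} \<subseteq> N"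
    by (auto simp: eventually_ae_filter)
  have "(\<Union>m::int. {x. x - of_int m \<in> N}) \<in> null_sets lborel"
    by (intro null_sets_UN null_sets_translation N)
  moreover have "{x. \<not> P x} \<subseteq> (\<Union>m::int. {x. x - of_int m \<in> N})"
  proof
    fix x assume "x \<in> {x. \<not> P x}"
    moreover have "P (frac x) = P x"
      using periodic_int[of P "frac x" "\<lfloor>x\<rfloor>", OF per] by (simp add: frac_def)
    ultimately have "frac x \<in> N" using N(2) frac_lt_1[of x] by auto
    then show "x \<in> (\<Union>m::int. {x. x - of_int m \<in> N})" by (auto simp: frac_def)
  qed
  ultimately show ?thesis by (auto simp: eventually_ae_filter)
qed

lemma LLN_lacunary:
  fixes f :: "real \<Rightarrow> real"
  assumes f: "circle_fun B f" "L1_lip M f" "(\<integral>x. f x \<partial>circ) = 0" and q: "lacunary q" and M: "M \<ge> 0"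
  shows "AE x in lborel. (\<lambda>N. (\<Sum>k<N. f (real (q k) * x)) / real N) \<longlonglongrightarrow> 0"
proof (rule AE_circ_imp_AE_lborel[OF LLN_lacunary_circ[OF assms]])
  fix x
  have "f (real (q k) * (x + 1)) = f (real (q k) * x)" for k
    using circle_funD(2)[OF circle_fun_scale[OF f(1), of "q k" 0]] by simp
  then show "(\<lambda>N. (\<Sum>k<N. f (real (q k) * (x + 1))) / real N) \<longlonglongrightarrow> 0
     \<longleftrightarrow> (\<lambda>N. (\<Sum>k<N. f (real (q k) * x)) / real N) \<longlonglongrightarrow> 0" by simp
qed

lemma AE_lborel_linear_form:
  fixes a b :: real
  assumes "AE z in lborel. P z" and ab: "a \<noteq> 0 \<or> b \<noteq> 0"
  shows "AE p in (lborel :: (real \<times> real) measure). P (a * fst p + b * snd p)"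
proof -
  obtain N where N: "N \<in> null_sets lborel" "{z. \<not> P z} \<subseteq> N"
    using assms(1) by (auto simp: eventually_ae_filter)
  have [measurable]: "N \<in> sets borel" using N(1) by auto
  have ae: "AE z in lborel. z \<notin> N" using N(1) by (rule AE_not_in)
  have "AE p in (lborel \<Otimes>\<^sub>M lborel :: (real \<times> real) measure). a * fst p + b * snd p \<notin> N"
  proof (rule lborel_pair.AE_pair_measure)
    show "{p \<in> space (lborel \<Otimes>\<^sub>M lborel). a * fst p + b * snd p \<notin> N} \<in> sets (lborel \<Otimes>\<^sub>M lborel)" by measurable
    show "AE x in lborel. AE y in lborel. a * fst (x, y) + b * snd (x, y) \<notin> N"
    proof (cases "b = 0")
      case True
      then have "AE x in lborel. 0 + a * x \<notin> N"
        using ab by (intro AE_borel_affine ae) auto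
      then show ?thesis by eventually_elim (use True in simp)
    next
      case False
      then show ?thesis using AE_borel_affine[OF False _ ae] by simp
    qed
  qed
  then have "AE p in (lborel :: (real \<times> real) measure). a * fst p + b * snd p \<notin> N"
    unfolding lborel_prod .
  then show ?thesis by eventually_elim (use N(2) in auto)
qed

section \<open>A central limit theorem along lacunary dilations\<close>

lemma norm_iexp_diff_le: "cmod (iexp a - iexp b) \<le> \<bar>a - b\<bar>"
proof -
  have "iexp a - iexp b = iexp b * (iexp (a - b) - 1)"
    by (simp add: algebra_simps exp_diff)
  then have "cmod (iexp a - iexp b) = cmod (iexp (a - b) - 1)"
    by (simp add: norm_mult)
  also have "\<dots> \<le> \<bar>a - b\<bar>" using iexp_approx1[of "a - b" 0] by simp
  finally show ?thesis .
qed

lemma circle_fun_iexp: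
  assumes "circle_fun B f"
  shows "circle_fun 1 (\<lambda>x. iexp (t * f x))"
proof (rule circle_funI)
  have [measurable]: "f \<in> borel_measurable borel" using circle_funD(1)[OF assms] .
  show "(\<lambda>x. iexp (t * f x)) \<in> borel_measurable borel" by measurable
qed (use circle_funD(2)[OF assms] in simp_all)

lemma L1_lip_iexp:
  assumes f: "circle_fun B f" "L1_lip M f"
  shows "L1_lip (\<bar>t\<bar> * M) (\<lambda>x. iexp (t * f x))"
  unfolding L1_lip_def
proof
  fix d
  have "(\<integral>x. norm (iexp (t * f (x + d)) - iexp (t * f x)) \<partial>circ) \<le> (\<integral>x. \<bar>t\<bar> * norm (f (x + d) - f x) \<partial>circ)"
  proof (rule integral_mono)
    show "integrable circ (\<lambda>x. norm (iexp (t * f (x + d)) - iexp (t * f x)))"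
      by (intro integrable_circle_fun[OF circle_fun_norm[OF circle_fun_diff[OF circle_fun_iexp[OF circle_fun_shift[OF f(1)]] circle_fun_iexp[OF f(1)]]]])
    show "integrable circ (\<lambda>x. \<bar>t\<bar> * norm (f (x + d) - f x))"
      by (intro integrable_mult_right integrable_circle_fun[OF circle_fun_norm[OF circle_fun_diff[OF circle_fun_shift[OF f(1)] f(1)]]])
    show "norm (iexp (t * f (x + d)) - iexp (t * f x)) \<le> \<bar>t\<bar> * norm (f (x + d) - f x)" for x
      using norm_iexp_diff_le[of "t * f (x + d)" "t * f x"] by (simp add: right_diff_distrib[symmetric] abs_mult)
  qed
  also have "\<dots> = \<bar>t\<bar> * (\<integral>x. norm (f (x + d) - f x) \<partial>circ)" by simp
  also have "\<dots> \<le> \<bar>t\<bar> * (M * \<bar>d\<bar>)" by (intro mult_left_mono L1_lipD f) simp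
  finally show "(\<integral>x. norm (iexp (t * f (x + d)) - iexp (t * f x)) \<partial>circ) \<le> \<bar>t\<bar> * M * \<bar>d\<bar>" by simp
qed

text \<open>
  The partial product of the first \<open>n\<close> factors has L1 modulus \<open>T\<close> times the sum of the first \<open>n\<close>
  dilations, so splitting off the next factor costs at most \<open>T / 2 ^ n\<close>.  The factor \<open>T\<close> in the bound
  is what matters: for the characteristic functions below it tends to 0.
\<close>
lemma lacunary_product:
  fixes H :: "nat \<Rightarrow> real \<Rightarrow> complex"
  assumes H: "\<And>k. circle_fun 1 (H k)" "\<And>k. L1_lip T (H k)" and T: "T \<ge> 0" and q: "lacunary q"
  shows "norm ((\<integral>x. (\<Prod>k<N. H k (real (q k) * x)) \<partial>circ) - (\<Prod>k<N. \<integral>x. H k x \<partial>circ)) \<le> 2 * T"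
proof -
  define F where "F n x = (\<Prod>k<n. H k (real (q k) * x))" for n x
  have h: "circle_fun 1 (\<lambda>x. H k (real (q k) * x))" for k using circle_fun_scale[OF H(1), where q="q k" and c=0] by simp
  have F: "circle_fun 1 (F n) \<and> L1_lip (T * (\<Sum>k<n. real (q k))) (F n)" for n
  proof (induction n)
    case 0 show ?case using L1_lip_const[of "1::complex"] by (simp add: F_def[abs_def] circle_fun_def)
  next
    case (Suc n)
    have "F (Suc n) = (\<lambda>x. F n x * H n (real (q n) * x))" by (simp add: F_def fun_eq_iff)
    then show ?case
      using circle_fun_mult[OF conjunct1[OF Suc] h[of n]]
        L1_lip_mult[OF conjunct1[OF Suc] conjunct2[OF Suc] h[of n] L1_lip_scale[OF H(1,2) lacunaryD(1)[OF q]]]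
      by (simp add: algebra_simps)
  qed
  have "norm ((\<integral>x. F n x \<partial>circ) - (\<Prod>k<n. \<integral>x. H k x \<partial>circ)) \<le> T * (\<Sum>k<n. (1/2) ^ k)" for n
  proof (induction n)
    case 0 show ?case by (simp add: F_def)
  next
    case (Suc n)
    let ?J = "\<integral>x. H n x \<partial>circ" and ?P = "\<Prod>k<n. \<integral>x. H k x \<partial>circ"
    have "norm ((\<integral>x. F n x * H n (real (q n) * x) \<partial>circ) - (\<integral>x. F n x \<partial>circ) * ?J) \<le> 1 * (T * (\<Sum>k<n. real (q k))) / real (q n)"
      using F by (intro circle_decouple[OF _ _ H(1) lacunaryD(1)[OF q]]) auto
    also have "\<dots> = T * ((\<Sum>k<n. real (q k)) / real (q n))" by simp
    also have "\<dots> \<le> T * (1/2) ^ n" by (intro mult_left_mono lacunaryD(2)[OF q] T)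
    finally have 1: "norm ((\<integral>x. F n x * H n (real (q n) * x) \<partial>circ) - (\<integral>x. F n x \<partial>circ) * ?J) \<le> T * (1/2) ^ n" .
    have 2: "norm (((\<integral>x. F n x \<partial>circ) - ?P) * ?J) \<le> (T * (\<Sum>k<n. (1/2) ^ k)) * 1"
      unfolding norm_mult using Suc norm_integral_circle_fun_le[OF H(1)[of n]] T
      by (intro mult_mono) (auto intro!: mult_nonneg_nonneg sum_nonneg)
    have "(\<integral>x. F (Suc n) x \<partial>circ) - (\<Prod>k<Suc n. \<integral>x. H k x \<partial>circ)
        = ((\<integral>x. F n x * H n (real (q n) * x) \<partial>circ) - (\<integral>x. F n x \<partial>circ) * ?J) + ((\<integral>x. F n x \<partial>circ) - ?P) * ?J"
      by (simp add: F_def algebra_simps)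
    also have "norm \<dots> \<le> T * (1/2) ^ n + (T * (\<Sum>k<n. (1/2) ^ k)) * 1"
      by (rule norm_triangle_mono[OF 1 2])
    finally show ?case by (simp add: algebra_simps)
  qed
  also have "T * (\<Sum>k<N. (1/2) ^ k) \<le> T * 2"
    using T by (intro mult_left_mono) (auto simp: sum_gp_strict)
  finally show ?thesis by (simp add: F_def)
qed

text \<open>
  The upper bound comes from \<open>exp (- w) \<le> 1 / (1 + w)\<close>.
\<close>
lemma exp_minus_approx:
  fixes w :: real
  assumes "w \<ge> 0"
  shows "\<bar>exp (- w) - (1 - w)\<bar> \<le> w\<^sup>2"
proof -
  have "exp (- w) \<ge> 1 - w" using exp_ge_add_one_self[of "-w"] by simp
  moreover have "exp (- w) \<le> 1 - w + w\<^sup>2"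
  proof -
    have "exp (- w) \<le> 1 / (1 + w)"
      unfolding exp_minus inverse_eq_divide using exp_ge_add_one_self[of w] assms
      by (intro divide_left_mono) auto
    also have "\<dots> \<le> 1 - w + w\<^sup>2"
    proof -
      have "(1 - w + w\<^sup>2) * (1 + w) = 1 + w ^ 3" by (simp add: algebra_simps power2_eq_square power3_eq_cube)
      then show ?thesis using assms by (simp add: pos_divide_le_eq)
    qed
    finally show ?thesis .
  qed
  ultimately show ?thesis by linarith
qed

lemma iexp_integral_approx:
  fixes G :: "real \<Rightarrow> real"
  assumes G: "circle_fun B G" "(\<integral>x. G x \<partial>circ) = 0"
  shows "norm ((\<integral>x. iexp (t * G x) \<partial>circ) - of_real (exp (- (t\<^sup>2 * (\<integral>x. G x * G x \<partial>circ) / 2))))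
     \<le> \<bar>t\<bar> ^ 3 * B ^ 3 + t ^ 4 * B ^ 4"
proof -
  define v where "v = (\<integral>x. G x * G x \<partial>circ)"
  define w where "w = t\<^sup>2 * v / 2"
  have B: "0 \<le> B" using circle_funD(4)[OF G(1)] .
  have v: "0 \<le> v" "v \<le> B * B"
    unfolding v_def using norm_integral_circle_fun_le[OF circle_fun_mult[OF G(1) G(1)]]
    by (auto intro: Bochner_Integration.integral_nonneg)
  have w: "0 \<le> w" using v by (simp add: w_def)
  have int1: "integrable circ (\<lambda>x. iexp (t * G x))"
    by (rule integrable_circle_fun[OF circle_fun_iexp[OF G(1)]])
  have intG: "integrable circ G" and intGG: "integrable circ (\<lambda>x. G x * G x)"
    using integrable_circle_fun[OF G(1)] integrable_circle_fun[OF circle_fun_mult[OF G(1) G(1)]] by auto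
  have i1: "integrable circ (\<lambda>x. \<i> * complex_of_real (t * G x))"
    and i2: "integrable circ (\<lambda>x. complex_of_real (t\<^sup>2 / 2 * (G x * G x)))"
    by (intro integrable_mult_right integrable_of_real intG intGG)+
  then have intP: "integrable circ (\<lambda>x. 1 + \<i> * complex_of_real (t * G x) - complex_of_real (t\<^sup>2 / 2 * (G x * G x)))"
    by (intro Bochner_Integration.integrable_diff Bochner_Integration.integrable_add) auto
  have "(\<integral>x. 1 + \<i> * complex_of_real (t * G x) - complex_of_real (t\<^sup>2 / 2 * (G x * G x)) \<partial>circ)
     = (\<integral>x. 1 \<partial>circ) + (\<integral>x. \<i> * complex_of_real (t * G x) \<partial>circ) - (\<integral>x. complex_of_real (t\<^sup>2 / 2 * (G x * G x)) \<partial>circ)"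
    using i1 i2 by (subst Bochner_Integration.integral_diff, simp, simp, subst Bochner_Integration.integral_add) auto
  also have "\<dots> = 1 + \<i> * complex_of_real (t * (\<integral>x. G x \<partial>circ)) - complex_of_real (t\<^sup>2 / 2 * v)"
    unfolding integral_mult_right_zero integral_complex_of_real v_def by simp
  finally have iP: "(\<integral>x. 1 + \<i> * complex_of_real (t * G x) - complex_of_real (t\<^sup>2 / 2 * (G x * G x)) \<partial>circ)
     = of_real (1 - w)" by (simp add: G(2) w_def)
  have "(\<integral>x. iexp (t * G x) \<partial>circ) - of_real (1 - w) = 
     (\<integral>x. iexp (t * G x) - (1 + \<i> * complex_of_real (t * G x) - complex_of_real (t\<^sup>2 / 2 * (G x * G x))) \<partial>circ)"
    unfolding iP[symmetric] by (rule Bochner_Integration.integral_diff[symmetric, OF int1 intP])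
  also have "norm \<dots> \<le> (\<integral>x. \<bar>t\<bar> ^ 3 * B ^ 3 \<partial>circ)"
  proof (rule Bochner_Integration.integral_norm_bound_integral)
    fix x
    have "iexp (t * G x) - (1 + \<i> * complex_of_real (t * G x) - complex_of_real (t\<^sup>2 / 2 * (G x * G x)))
      = iexp (t * G x) - (\<Sum>k\<le>2. (\<i> * complex_of_real (t * G x)) ^ k / fact k)"
      by (simp add: numeral_2_eq_2 power2_eq_square fact_numeral field_simps)
    also have "norm \<dots> \<le> \<bar>t * G x\<bar> ^ Suc 2 / fact (Suc 2)" by (rule iexp_approx1)
    also have "\<dots> \<le> \<bar>t * G x\<bar> ^ 3 / 1"
    proof -
      have "Suc 2 = 3" by simp
      then show ?thesis by (simp only:) (intro divide_left_mono; simp add: fact_ge_1)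
    qed
    also have "\<dots> = \<bar>t * G x\<bar> ^ 3" by simp
    also have "\<dots> = \<bar>t\<bar> ^ 3 * \<bar>G x\<bar> ^ 3" by (simp add: abs_mult power_mult_distrib)
    also have "\<dots> \<le> \<bar>t\<bar> ^ 3 * B ^ 3"
      using circle_funD(3)[OF G(1), of x] by (intro mult_left_mono power_mono) auto
    finally show "norm (iexp (t * G x) - (1 + \<i> * complex_of_real (t * G x) - complex_of_real (t\<^sup>2 / 2 * (G x * G x)))) \<le> \<bar>t\<bar> ^ 3 * B ^ 3" .
  qed (use int1 intP in auto)
  also have "\<dots> = \<bar>t\<bar> ^ 3 * B ^ 3" by simp
  finally have 1: "norm ((\<integral>x. iexp (t * G x) \<partial>circ) - of_real (1 - w)) \<le> \<bar>t\<bar> ^ 3 * B ^ 3" .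
  have "norm (complex_of_real (1 - w) - of_real (exp (- w))) = \<bar>exp (- w) - (1 - w)\<bar>"
    unfolding of_real_diff[symmetric] norm_of_real by (simp add: abs_minus_commute)
  also have "\<dots> \<le> w\<^sup>2" by (rule exp_minus_approx[OF w])
  also have "\<dots> \<le> (t\<^sup>2 * (B * B))\<^sup>2"
  proof (rule power_mono[OF _ w])
    have "t\<^sup>2 * v \<le> t\<^sup>2 * (B * B)" using v by (intro mult_left_mono) auto
    moreover have "0 \<le> t\<^sup>2 * (B * B)" by simp
    ultimately show "w \<le> t\<^sup>2 * (B * B)" unfolding w_def by linarith
  qed
  also have "\<dots> = t ^ 4 * B ^ 4" by (simp add: power_mult_distrib power2_eq_square power4_eq_xxxx)
  finally have 2: "norm (complex_of_real (1 - w) - of_real (exp (- w))) \<le> t ^ 4 * B ^ 4" .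
  show ?thesis using norm_triangle_mono[OF 1 2] by (simp add: w_def v_def)
qed

text \<open>
  With \<open>t = s / sqrt N\<close>, the factors \<open>exp (i t G\<^sub>k)\<close> have L1 modulus \<open>|t| M\<close>.  The characteristic
  function of the sum is thus within \<open>2 |t| M\<close> of the product of the individual ones, each of which
  is Gaussian up to an error of order \<open>|t| ^ 3\<close>; the \<open>N\<close> errors add up to order \<open>1 / sqrt N\<close>.
\<close>
lemma CLT_lacunary:
  fixes G :: "nat \<Rightarrow> real \<Rightarrow> real"
  assumes G: "\<And>k. circle_fun B (G k)" "\<And>k. L1_lip M (G k)" "\<And>k. (\<integral>x. G k x \<partial>circ) = 0"
    and M: "M \<ge> 0" and q: "lacunary q"
    and var: "(\<lambda>N. (\<Sum>k<N. \<integral>x. G k x * G k x \<partial>circ) / real N) \<longlonglongrightarrow> v"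
  shows "(\<lambda>N. \<integral>x. iexp (s / sqrt (real N) * (\<Sum>k<N. G k (real (q k) * x))) \<partial>circ)
     \<longlonglongrightarrow> of_real (exp (- (s\<^sup>2 * v / 2)))"
proof -
  define t where "t N = s / sqrt (real N)" for N
  define V where "V k = (\<integral>x. G k x * G k x \<partial>circ)" for k
  define J where "J N k = (\<integral>x. iexp (t N * G k x) \<partial>circ)" for N k
  define E where "E N k = complex_of_real (exp (- ((t N)\<^sup>2 * V k / 2)))" for N k
  define I where "I N = (\<integral>x. iexp (t N * (\<Sum>k<N. G k (real (q k) * x))) \<partial>circ)" for N
  have B: "0 \<le> B" using circle_funD(4)[OF G(1)] .
  have V: "0 \<le> V k" for k unfolding V_def by (auto intro: Bochner_Integration.integral_nonneg)
  have 1: "norm (I N - (\<Prod>k<N. J N k)) \<le> 2 * (\<bar>t N\<bar> * M)" for N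
  proof -
    have "I N = (\<integral>x. (\<Prod>k<N. iexp (t N * G k (real (q k) * x))) \<partial>circ)"
      by (simp add: I_def sum_distrib_left exp_sum)
    then show ?thesis
      unfolding J_def
      using lacunary_product[where H="\<lambda>k x. iexp (t N * G k x)" and N=N, OF circle_fun_iexp[OF G(1)] L1_lip_iexp[OF G(1,2)] _ q] M
      by simp
  qed
  have 2: "norm ((\<Prod>k<N. J N k) - (\<Prod>k<N. E N k)) \<le> real N * (\<bar>t N\<bar> ^ 3 * B ^ 3 + t N ^ 4 * B ^ 4)" for N
  proof -
    have "norm ((\<Prod>k<N. J N k) - (\<Prod>k<N. E N k)) \<le> (\<Sum>k<N. norm (J N k - E N k))"
    proof (rule norm_prod_diff)
      show "norm (J N k) \<le> 1" for k unfolding J_def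
        by (rule norm_integral_circle_fun_le[OF circle_fun_iexp[OF G(1)]])
      show "norm (E N k) \<le> 1" for k using V[of k] unfolding E_def norm_of_real by simp
    qed
    also have "\<dots> \<le> (\<Sum>k<N. \<bar>t N\<bar> ^ 3 * B ^ 3 + t N ^ 4 * B ^ 4)"
      unfolding J_def E_def V_def by (intro sum_mono iexp_integral_approx G)
    finally show ?thesis by simp
  qed
  have sq: "filterlim (\<lambda>N. sqrt (real N)) at_top sequentially"
    by (rule filterlim_compose[OF sqrt_at_top filterlim_real_sequentially])
  have inv: "(\<lambda>N. c / sqrt (real N)) \<longlonglongrightarrow> 0" for c
    by (rule real_tendsto_divide_at_top[OF tendsto_const sq])
  have l1: "(\<lambda>N. 2 * (\<bar>t N\<bar> * M)) \<longlonglongrightarrow> 0"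
    using tendsto_mult_left[OF inv[of "\<bar>s\<bar> * M"], of 2] by (simp add: t_def abs_divide)
  have l2: "(\<lambda>N. real N * (\<bar>t N\<bar> ^ 3 * B ^ 3 + t N ^ 4 * B ^ 4)) \<longlonglongrightarrow> 0"
  proof -
    have "real N * (\<bar>t N\<bar> ^ 3 * B ^ 3 + t N ^ 4 * B ^ 4) = (\<bar>s\<bar> ^ 3 * B ^ 3) / sqrt (real N) + (s ^ 4 * B ^ 4) / real N" for N
    proof (cases "N = 0")
      case False
      define r where "r = sqrt (real N)"
      have r: "r > 0" "real N = r * r" using False by (auto simp: r_def)
      show ?thesis unfolding t_def r_def[symmetric] unfolding r(2)
        using r(1) by (simp add: field_simps abs_divide power_divide power3_eq_cube power4_eq_xxxx)
    qed simp
    moreover have "(\<lambda>N. (\<bar>s\<bar> ^ 3 * B ^ 3) / sqrt (real N) + (s ^ 4 * B ^ 4) / real N) \<longlonglongrightarrow> 0 + 0"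
      by (intro tendsto_add inv lim_const_over_n)
    ultimately show ?thesis by simp
  qed
  have l3: "(\<lambda>N. \<Prod>k<N. E N k) \<longlonglongrightarrow> of_real (exp (- (s\<^sup>2 * v / 2)))"
  proof -
    have "(\<Prod>k<N. E N k) = of_real (exp (- (s\<^sup>2 * ((\<Sum>k<N. V k) / real N) / 2)))" for N
    proof -
      have "(\<Prod>k<N. E N k) = of_real (exp (\<Sum>k<N. - ((t N)\<^sup>2 * V k / 2)))"
        by (simp add: E_def exp_sum)
      also have "(\<Sum>k<N. - ((t N)\<^sup>2 * V k / 2)) = - ((t N)\<^sup>2 * (\<Sum>k<N. V k) / 2)"
        by (simp add: sum_negf sum_distrib_left sum_divide_distrib)
      also have "(t N)\<^sup>2 = s\<^sup>2 / real N" by (simp add: t_def power_divide)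
      finally show ?thesis by simp
    qed
    moreover have "(\<lambda>N. complex_of_real (exp (- (s\<^sup>2 * ((\<Sum>k<N. V k) / real N) / 2)))) \<longlonglongrightarrow> of_real (exp (- (s\<^sup>2 * v / 2)))"
      using var unfolding V_def by (intro tendsto_intros) auto
    ultimately show ?thesis by simp
  qed
  have "(\<lambda>N. I N - (\<Prod>k<N. E N k)) \<longlonglongrightarrow> 0"
  proof (rule Lim_null_comparison)
    show "\<forall>\<^sub>F N in sequentially. norm (I N - (\<Prod>k<N. E N k))
        \<le> 2 * (\<bar>t N\<bar> * M) + real N * (\<bar>t N\<bar> ^ 3 * B ^ 3 + t N ^ 4 * B ^ 4)"
    proof (rule always_eventually, rule allI)
      fix N show "norm (I N - (\<Prod>k<N. E N k)) \<le> 2 * (\<bar>t N\<bar> * M) + real N * (\<bar>t N\<bar> ^ 3 * B ^ 3 + t N ^ 4 * B ^ 4)"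
        using norm_triangle_mono[OF 1[of N] 2[of N]] by simp
    qed
    show "(\<lambda>N. 2 * (\<bar>t N\<bar> * M) + real N * (\<bar>t N\<bar> ^ 3 * B ^ 3 + t N ^ 4 * B ^ 4)) \<longlonglongrightarrow> 0"
      using tendsto_add[OF l1 l2] by simp
  qed
  from tendsto_add[OF this l3] show ?thesis by (simp add: I_def t_def)
qed

text \<open>
  A discrepancy that stays bounded in L1 disappears after division by \<open>sqrt N\<close>.
\<close>
lemma iexp_L1_perturbation:
  fixes X Y :: "nat \<Rightarrow> real \<Rightarrow> real"
  assumes X: "\<And>N. circle_fun (A N) (X N)" and Y: "\<And>N. circle_fun (B N) (Y N)"
    and C: "\<And>N. (\<integral>x. \<bar>X N x - Y N x\<bar> \<partial>circ) \<le> C"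
    and lim: "(\<lambda>N. \<integral>x. iexp (s / sqrt (real N) * Y N x) \<partial>circ) \<longlonglongrightarrow> L"
  shows "(\<lambda>N. \<integral>x. iexp (s / sqrt (real N) * X N x) \<partial>circ) \<longlonglongrightarrow> L"
proof -
  have "(\<lambda>N. (\<integral>x. iexp (s / sqrt (real N) * X N x) \<partial>circ) - (\<integral>x. iexp (s / sqrt (real N) * Y N x) \<partial>circ)) \<longlonglongrightarrow> 0"
  proof (rule Lim_null_comparison)
    show "\<forall>\<^sub>F N in sequentially. norm ((\<integral>x. iexp (s / sqrt (real N) * X N x) \<partial>circ) - (\<integral>x. iexp (s / sqrt (real N) * Y N x) \<partial>circ))
       \<le> (\<bar>s\<bar> * C) / sqrt (real N)"
    proof (rule always_eventually, rule allI)
      fix N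
      let ?t = "s / sqrt (real N)"
      have i: "integrable circ (\<lambda>x. iexp (?t * X N x))" "integrable circ (\<lambda>x. iexp (?t * Y N x))"
        by (rule integrable_circle_fun[OF circle_fun_iexp[OF X]], rule integrable_circle_fun[OF circle_fun_iexp[OF Y]])
      have "(\<integral>x. iexp (?t * X N x) \<partial>circ) - (\<integral>x. iexp (?t * Y N x) \<partial>circ) = (\<integral>x. iexp (?t * X N x) - iexp (?t * Y N x) \<partial>circ)"
        by (rule Bochner_Integration.integral_diff[OF i, symmetric])
      also have "norm \<dots> \<le> (\<integral>x. \<bar>?t\<bar> * \<bar>X N x - Y N x\<bar> \<partial>circ)"
      proof (rule Bochner_Integration.integral_norm_bound_integral)
        show "integrable circ (\<lambda>x. iexp (?t * X N x) - iexp (?t * Y N x))" using i by (rule Bochner_Integration.integrable_diff)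
        show "integrable circ (\<lambda>x. \<bar>?t\<bar> * \<bar>X N x - Y N x\<bar>)"
          using integrable_circle_fun[OF circle_fun_norm[OF circle_fun_diff[OF X Y]]] by (intro integrable_mult_right) simp
        show "norm (iexp (?t * X N x) - iexp (?t * Y N x)) \<le> \<bar>?t\<bar> * \<bar>X N x - Y N x\<bar>" for x
          using norm_iexp_diff_le[of "?t * X N x" "?t * Y N x"] unfolding right_diff_distrib[symmetric] abs_mult .
      qed
      also have "\<dots> = \<bar>?t\<bar> * (\<integral>x. \<bar>X N x - Y N x\<bar> \<partial>circ)" by simp
      also have "\<dots> \<le> \<bar>?t\<bar> * C" by (intro mult_left_mono C) simp
      finally show "norm ((\<integral>x. iexp (?t * X N x) \<partial>circ) - (\<integral>x. iexp (?t * Y N x) \<partial>circ)) \<le> (\<bar>s\<bar> * C) / sqrt (real N)"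
        by (simp add: abs_divide)
    qed
    show "(\<lambda>N. (\<bar>s\<bar> * C) / sqrt (real N)) \<longlonglongrightarrow> 0"
      by (rule real_tendsto_divide_at_top[OF tendsto_const filterlim_compose[OF sqrt_at_top filterlim_real_sequentially]])
  qed
  from tendsto_add[OF this lim] show ?thesis by simp
qed

section \<open>The sawtooth form of the cocycle\<close>

text \<open>
  For \<open>0 \<le> b < 1\<close> this agrees with \<open>phi b c\<close> outside the right end points of the arcs.
\<close>
definition psi :: "real \<Rightarrow> real \<Rightarrow> real \<Rightarrow> real" where
  "psi b c x = saw (x - b) - saw x - saw (x - b - c) + saw (x - c)"

lemma circle_fun_psi: "circle_fun 2 (psi b c)"
proof -
  have "circle_fun (1/2 + 1/2 + 1/2 + 1/2) (\<lambda>x. saw (x + (- b)) - saw x - saw (x + (- b - c)) + saw (x + (- c)))"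
    by (intro circle_fun_add circle_fun_diff circle_fun_shift circle_fun_saw)
  moreover have "psi b c = (\<lambda>x. saw (x + (- b)) - saw x - saw (x + (- b - c)) + saw (x + (- c)))"
    by (simp add: psi_def fun_eq_iff algebra_simps)
  ultimately show ?thesis by simp
qed

lemma L1_lip_psi: "L1_lip 8 (psi b c)"
proof -
  note s = circle_fun_shift[OF circle_fun_saw] and l = L1_lip_shift[OF circle_fun_saw L1_lip_saw]
  have "L1_lip (2 + 2 + (2 + 2)) (\<lambda>x. (saw (x + (- b)) + - saw (x + 0)) + (- saw (x + (- b - c)) + saw (x + (- c))))"
    by (intro L1_lip_add[OF circle_fun_add[OF s circle_fun_uminus[OF s]] L1_lip_add[OF s l circle_fun_uminus[OF s] L1_lip_uminus[OF l]]
        circle_fun_add[OF circle_fun_uminus[OF s] s] L1_lip_add[OF circle_fun_uminus[OF s] L1_lip_uminus[OF l] s l]])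
  moreover have "psi b c = (\<lambda>x. (saw (x + (- b)) + - saw (x + 0)) + (- saw (x + (- b - c)) + saw (x + (- c))))"
    by (simp add: psi_def fun_eq_iff algebra_simps)
  ultimately show ?thesis by simp
qed

lemma integral_psi: "(\<integral>x. psi b c x \<partial>circ) = 0"
proof -
  have i: "integrable circ (\<lambda>x. saw (x + a))" for a
    by (rule integrable_circle_fun[OF circle_fun_shift[OF circle_fun_saw]])
  have z: "(\<integral>x. saw (x + a) \<partial>circ) = 0" for a
    using integral_circ_translate[OF circle_fun_saw, of a] integral_saw_powers by simp
  have "psi b c = (\<lambda>x. saw (x + (- b)) - saw (x + 0) - saw (x + (- b - c)) + saw (x + (- c)))"
    by (simp add: psi_def fun_eq_iff algebra_simps)
  then show ?thesis by (simp add: i z del: diff_conv_add_uminus add_uminus_conv_diff add_0_right)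
qed

text \<open>
  Six cross terms of four translates; the products pairing translates at the same distance are
  merged by symmetry of \<open>corr\<close>, and the four diagonal terms give \<open>4 corr 0 = 1/3\<close>.
\<close>
lemma integral_psi_square:
  "(\<integral>x. psi b c x * psi b c x \<partial>circ) = 1/3 + 2 * (corr (b - c) + corr (b + c)) - 4 * (corr b + corr c)"
proof -
  have i: "integrable circ (\<lambda>x. saw (x + a) * saw (x + a'))" for a a'
    by (rule integrable_circle_fun[OF circle_fun_mult[OF circle_fun_shift[OF circle_fun_saw] circle_fun_shift[OF circle_fun_saw]]])
  have c: "corr (- b - c) = corr (b + c)" "corr (- c - - b) = corr (b - c)"
    using corr_minus[of "b + c"] by (simp_all add: algebra_simps)
  define A B C D where "A x = saw (x + (- b))" and "B x = saw (x + 0)" and "C x = saw (x + (- b - c))" and "D x = saw (x + (- c))" for x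
  have ints: "integrable circ (\<lambda>x. f x * g x)" if "f \<in> {A, B, C, D}" "g \<in> {A, B, C, D}" for f g
    using that unfolding A_def B_def C_def D_def by (auto simp del: add_uminus_conv_diff add_0_right intro: i)
  have "(\<integral>x. psi b c x * psi b c x \<partial>circ) = (\<integral>x. A x * A x + B x * B x + C x * C x + D x * D x
     + 2 * (A x * D x) + 2 * (B x * C x) - 2 * (A x * B x) - 2 * (A x * C x) - 2 * (B x * D x) - 2 * (C x * D x) \<partial>circ)"
    by (intro Bochner_Integration.integral_cong refl)
       (simp add: psi_def A_def B_def C_def D_def diff_diff_eq algebra_simps)
  also have "\<dots> = (\<integral>x. A x * A x \<partial>circ) + (\<integral>x. B x * B x \<partial>circ) + (\<integral>x. C x * C x \<partial>circ) + (\<integral>x. D x * D x \<partial>circ)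
     + 2 * (\<integral>x. A x * D x \<partial>circ) + 2 * (\<integral>x. B x * C x \<partial>circ) - 2 * (\<integral>x. A x * B x \<partial>circ) - 2 * (\<integral>x. A x * C x \<partial>circ)
     - 2 * (\<integral>x. B x * D x \<partial>circ) - 2 * (\<integral>x. C x * D x \<partial>circ)"
    by (simp add: ints)
  also have "\<dots> = 1/3 + 2 * (corr (b - c) + corr (b + c)) - 4 * (corr b + corr c)"
    unfolding A_def B_def C_def D_def integral_saw_saw using c by (simp add: corr_0 corr_minus)
  finally show ?thesis .
qed

lemma psi_sum_rational_rotation:
  fixes p :: int
  assumes q: "q > 0" and cop: "coprime p (int q)"
  shows "(\<Sum>j=1..q. psi b c (x + real j * (of_int p / real q))) = psi (real q * b) (real q * c) (real q * x)"
proof -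
  note S = saw_sum_rational_rotation[OF q cop]
  have "(\<Sum>j=1..q. psi b c (x + real j * (of_int p / real q)))
     = (\<Sum>j=1..q. saw ((x - b) + real j * (of_int p / real q))) - (\<Sum>j=1..q. saw (x + real j * (of_int p / real q)))
      - (\<Sum>j=1..q. saw ((x - b - c) + real j * (of_int p / real q))) + (\<Sum>j=1..q. saw ((x - c) + real j * (of_int p / real q)))"
    unfolding psi_def sum.distrib sum_subtractf by (simp add: algebra_simps)
  also have "\<dots> = psi (real q * b) (real q * c) (real q * x)"
    unfolding S psi_def by (simp add: right_diff_distrib)
  finally show ?thesis .
qed

text \<open>
  Each of the \<open>q\<close> summands is translated by at most \<open>q |\<alpha> - p / q|\<close>, which costs 8 times that in
  L1.
\<close>
lemma psi_block_error:
  fixes p :: int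
  assumes q: "q > 0" and cop: "coprime p (int q)"
  shows "(\<integral>x. \<bar>(\<Sum>j=1..q. psi b c (x + a + real j * \<alpha>)) - psi (real q * b) (real q * c) (real q * (x + a))\<bar> \<partial>circ)
     \<le> 8 * real q * \<bar>real q * \<alpha> - of_int p\<bar>"
proof -
  define r where "r = of_int p / real q"
  have i: "integrable circ (\<lambda>x. \<bar>psi b c (x + e) - psi b c (x + e')\<bar>)" for e e'
    using integrable_circle_fun[OF circle_fun_norm[OF circle_fun_diff[OF circle_fun_shift[OF circle_fun_psi] circle_fun_shift[OF circle_fun_psi]]]]
    by simp
  have e: "(\<integral>x. \<bar>psi b c (x + (a + real j * \<alpha>)) - psi b c (x + (a + real j * r))\<bar> \<partial>circ) \<le> 8 * \<bar>real q * \<alpha> - of_int p\<bar>"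
    if j: "j \<in> {1..q}" for j
  proof -
    have "(\<integral>x. \<bar>psi b c (x + (a + real j * \<alpha>)) - psi b c (x + (a + real j * r))\<bar> \<partial>circ)
       \<le> 8 * \<bar>(a + real j * \<alpha>) - (a + real j * r)\<bar>"
      using L1_shift[OF circle_fun_psi L1_lip_psi, of b c "a + real j * \<alpha>" "a + real j * r"]
      unfolding real_norm_def .
    also have "\<bar>(a + real j * \<alpha>) - (a + real j * r)\<bar> = real j * \<bar>\<alpha> - r\<bar>"
      by (simp add: abs_mult flip: right_diff_distrib)
    also have "\<dots> \<le> real q * \<bar>\<alpha> - r\<bar>" using j by (intro mult_right_mono) auto
    also have "\<dots> = \<bar>real q * \<alpha> - of_int p\<bar>"
      using q unfolding r_def by (subst abs_of_nat[symmetric], subst abs_mult[symmetric]) (simp add: right_diff_distrib)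
    finally show ?thesis by simp
  qed
  have "(\<integral>x. \<bar>(\<Sum>j=1..q. psi b c (x + a + real j * \<alpha>)) - psi (real q * b) (real q * c) (real q * (x + a))\<bar> \<partial>circ)
     = (\<integral>x. \<bar>\<Sum>j=1..q. psi b c (x + (a + real j * \<alpha>)) - psi b c (x + (a + real j * r))\<bar> \<partial>circ)"
    unfolding psi_sum_rational_rotation[OF q cop, symmetric] r_def by (simp add: sum_subtractf add.assoc)
  also have "\<dots> \<le> (\<integral>x. (\<Sum>j=1..q. \<bar>psi b c (x + (a + real j * \<alpha>)) - psi b c (x + (a + real j * r))\<bar>) \<partial>circ)"
  proof (rule integral_mono)
    show "integrable circ (\<lambda>x. \<bar>\<Sum>j=1..q. psi b c (x + (a + real j * \<alpha>)) - psi b c (x + (a + real j * r))\<bar>)"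
      by (intro integrable_abs Bochner_Integration.integrable_sum integrable_circle_fun[OF circle_fun_diff[OF circle_fun_shift[OF circle_fun_psi] circle_fun_shift[OF circle_fun_psi]]])
    show "integrable circ (\<lambda>x. \<Sum>j=1..q. \<bar>psi b c (x + (a + real j * \<alpha>)) - psi b c (x + (a + real j * r))\<bar>)"
      by (intro Bochner_Integration.integrable_sum i)
  qed (rule sum_abs)
  also have "\<dots> = (\<Sum>j=1..q. \<integral>x. \<bar>psi b c (x + (a + real j * \<alpha>)) - psi b c (x + (a + real j * r))\<bar> \<partial>circ)"
    by (intro Bochner_Integration.integral_sum i)
  also have "\<dots> \<le> (\<Sum>j=1..q. 8 * \<bar>real q * \<alpha> - of_int p\<bar>)" by (intro sum_mono e)
  finally show ?thesis by simp
qed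

lemma sum_blocks:
  fixes f :: "nat \<Rightarrow> 'a::comm_monoid_add" and q :: "nat \<Rightarrow> nat"
  shows "(\<Sum>j=1..(\<Sum>k<N. q k). f j) = (\<Sum>k<N. \<Sum>j=1..q k. f ((\<Sum>i<k. q i) + j))"
proof (induction N)
  case (Suc N)
  have "(\<Sum>j=1..(\<Sum>k<N. q k) + q N. f j) = (\<Sum>j=1..(\<Sum>k<N. q k). f j) + (\<Sum>j=(\<Sum>k<N. q k)+1..(\<Sum>k<N. q k) + q N. f j)"
    by (rule sum.ub_add_nat) simp
  also have "(\<Sum>j=(\<Sum>k<N. q k)+1..(\<Sum>k<N. q k) + q N. f j) = (\<Sum>j=1..q N. f ((\<Sum>i<N. q i) + j))"
    using sum.shift_bounds_cl_nat_ivl[of f 1 "\<Sum>k<N. q k" "q N"] by (simp add: add.commute)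
  finally show ?case using Suc by simp
qed simp

text \<open>
  The limit variance is \<open>1/3\<close>: this is where the averages of the autocorrelation terms must vanish.
  The phases \<open>a k\<close> by which the blocks start out are kept as translations inside \<open>G\<close>; they affect
  neither means nor variances nor L1 moduli.
\<close>
lemma CLT_psi:
  assumes \<alpha>: "\<alpha> \<in> {0<..<1}" "\<alpha> \<notin> \<rat>"
    and u: "\<And>k. partial_quotient \<alpha> (Suc (u k)) \<ge> 2 ^ k" and q: "lacunary (\<lambda>k. cf_denom \<alpha> (u k))"
    and lim: "\<And>z. z \<in> {b, c, b - c, b + c} \<Longrightarrow> (\<lambda>N. (\<Sum>k<N. corr (real (cf_denom \<alpha> (u k)) * z)) / real N) \<longlonglongrightarrow> 0"
  shows "(\<lambda>N. \<integral>x. iexp (s / sqrt (real N) * (\<Sum>j=1..(\<Sum>k<N. cf_denom \<alpha> (u k)). psi b c (x + real j * \<alpha>))) \<partial>circ)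
     \<longlonglongrightarrow> of_real (exp (- (s\<^sup>2 / 6)))"
proof -
  define q where "q k = cf_denom \<alpha> (u k)" for k
  define a where "a k = real (\<Sum>i<k. q i) * \<alpha>" for k
  define G where "G k y = psi (real (q k) * b) (real (q k) * c) (y + real (q k) * a k)" for k y
  define X where "X k x = (\<Sum>j=1..q k. psi b c (x + a k + real j * \<alpha>))" for k x
  have q': "lacunary q" using q by (simp add: q_def[abs_def])
  have qpos: "q k > 0" for k by (rule lacunaryD(1)[OF q'])
  have G1: "circle_fun 2 (G k)" for k unfolding G_def[abs_def] by (rule circle_fun_shift[OF circle_fun_psi])
  have G2: "L1_lip 8 (G k)" for k unfolding G_def[abs_def] by (rule L1_lip_shift[OF circle_fun_psi L1_lip_psi])
  have G3: "(\<integral>x. G k x \<partial>circ) = 0" for k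
    unfolding G_def using integral_circ_translate[OF circle_fun_psi] integral_psi by simp
  have G4: "(\<integral>x. G k x * G k x \<partial>circ) = 1/3 + 2 * (corr (real (q k) * (b - c)) + corr (real (q k) * (b + c)))
      - 4 * (corr (real (q k) * b) + corr (real (q k) * c))" for k
    using integral_circ_translate[OF circle_fun_mult[OF circle_fun_psi circle_fun_psi]]
    by (simp add: G_def integral_psi_square right_diff_distrib distrib_left)
  have var: "(\<lambda>N. (\<Sum>k<N. \<integral>x. G k x * G k x \<partial>circ) / real N) \<longlonglongrightarrow> 1/3"
  proof -
    have "(\<lambda>N. 1/3 + 2 * ((\<Sum>k<N. corr (real (q k) * (b - c))) / real N + (\<Sum>k<N. corr (real (q k) * (b + c))) / real N)
       - 4 * ((\<Sum>k<N. corr (real (q k) * b)) / real N + (\<Sum>k<N. corr (real (q k) * c)) / real N)) \<longlonglongrightarrow> 1/3 + 2 * (0 + 0) - 4 * (0 + 0)"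
      unfolding q_def by (intro tendsto_intros lim) auto
    then have "(\<lambda>N. 1/3 + 2 * ((\<Sum>k<N. corr (real (q k) * (b - c))) / real N + (\<Sum>k<N. corr (real (q k) * (b + c))) / real N)
       - 4 * ((\<Sum>k<N. corr (real (q k) * b)) / real N + (\<Sum>k<N. corr (real (q k) * c)) / real N)) \<longlonglongrightarrow> 1/3" by simp
    then show ?thesis
    proof (rule Lim_transform_eventually)
      show "\<forall>\<^sub>F N in sequentially. 1/3 + 2 * ((\<Sum>k<N. corr (real (q k) * (b - c))) / real N + (\<Sum>k<N. corr (real (q k) * (b + c))) / real N)
       - 4 * ((\<Sum>k<N. corr (real (q k) * b)) / real N + (\<Sum>k<N. corr (real (q k) * c)) / real N)
       = (\<Sum>k<N. \<integral>x. G k x * G k x \<partial>circ) / real N"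
        using eventually_gt_at_top[of 0]
        by eventually_elim (simp add: G4 sum.distrib sum_subtractf sum_distrib_left[symmetric] add_divide_distrib diff_divide_distrib distrib_left)
    qed
  qed
  have clt: "(\<lambda>N. \<integral>x. iexp (s / sqrt (real N) * (\<Sum>k<N. G k (real (q k) * x))) \<partial>circ) \<longlonglongrightarrow> of_real (exp (- (s\<^sup>2 * (1/3) / 2)))"
    by (rule CLT_lacunary[OF G1 G2 G3 _ q' var]) simp
  have Xc: "circle_fun (real (q k) * 2) (X k)" for k
    using circle_fun_sum[of "{1..q k}" "\<lambda>_. 2" "\<lambda>j x. psi b c (x + (a k + real j * \<alpha>))", OF _ circle_fun_shift[OF circle_fun_psi]]
    by (simp add: X_def[abs_def] add.assoc)
  have Gc: "circle_fun 2 (\<lambda>x. G k (real (q k) * x))" for k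
    using circle_fun_scale[OF G1, where q="q k" and c=0] by simp
  have err: "(\<integral>x. \<bar>X k x - G k (real (q k) * x)\<bar> \<partial>circ) \<le> 8 * (1/2) ^ k" for k
  proof -
    obtain p :: int where p: "coprime p (int (q k))" "\<bar>real (q k) * \<alpha> - of_int p\<bar> \<le> 1 / real (cf_denom \<alpha> (Suc (u k)))"
      using cf_rational_approximation[OF \<alpha>] unfolding q_def by metis
    have "(\<integral>x. \<bar>X k x - G k (real (q k) * x)\<bar> \<partial>circ) \<le> 8 * real (q k) * \<bar>real (q k) * \<alpha> - of_int p\<bar>"
      using psi_block_error[OF qpos p(1), of b c "a k" \<alpha>] by (simp add: X_def G_def distrib_left)
    also have "\<dots> \<le> 8 * real (q k) * (1 / real (cf_denom \<alpha> (Suc (u k))))"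
      by (intro mult_left_mono p) auto
    also have "\<dots> \<le> 8 * real (q k) * (1 / (2 ^ k * real (q k)))"
    proof (intro mult_left_mono divide_left_mono)
      have "2 ^ k * q k \<le> partial_quotient \<alpha> (Suc (u k)) * q k" by (intro mult_right_mono u) simp
      also have "\<dots> \<le> cf_denom \<alpha> (Suc (u k))" unfolding q_def by (rule cf_denom_Suc_ge[OF \<alpha>(2)])
      finally have "real (2 ^ k * q k) \<le> real (cf_denom \<alpha> (Suc (u k)))" by (rule of_nat_mono)
      then show "2 ^ k * real (q k) \<le> real (cf_denom \<alpha> (Suc (u k)))" by simp
    qed (use qpos cf_denom_pos[OF \<alpha>(2)] in auto)
    also have "\<dots> = 8 * (1/2) ^ k" using qpos[of k] by (simp add: power_divide)
    finally show ?thesis .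
  qed
  have total: "(\<integral>x. \<bar>(\<Sum>k<N. X k x) - (\<Sum>k<N. G k (real (q k) * x))\<bar> \<partial>circ) \<le> 16" for N
  proof -
    have i: "integrable circ (\<lambda>x. \<bar>X k x - G k (real (q k) * x)\<bar>)" for k
      using integrable_circle_fun[OF circle_fun_norm[OF circle_fun_diff[OF Xc Gc]]] by simp
    have "(\<integral>x. \<bar>(\<Sum>k<N. X k x) - (\<Sum>k<N. G k (real (q k) * x))\<bar> \<partial>circ) \<le> (\<integral>x. (\<Sum>k<N. \<bar>X k x - G k (real (q k) * x)\<bar>) \<partial>circ)"
    proof (rule integral_mono)
      show "integrable circ (\<lambda>x. \<bar>(\<Sum>k<N. X k x) - (\<Sum>k<N. G k (real (q k) * x))\<bar>)"
        by (intro integrable_abs Bochner_Integration.integrable_diff Bochner_Integration.integrable_sum integrable_circle_fun[OF Xc] integrable_circle_fun[OF Gc])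
      show "integrable circ (\<lambda>x. \<Sum>k<N. \<bar>X k x - G k (real (q k) * x)\<bar>)" by (intro Bochner_Integration.integrable_sum i)
      show "\<bar>(\<Sum>k<N. X k x) - (\<Sum>k<N. G k (real (q k) * x))\<bar> \<le> (\<Sum>k<N. \<bar>X k x - G k (real (q k) * x)\<bar>)" for x
        unfolding sum_subtractf[symmetric] by (rule sum_abs)
    qed
    also have "\<dots> = (\<Sum>k<N. \<integral>x. \<bar>X k x - G k (real (q k) * x)\<bar> \<partial>circ)"
      by (intro Bochner_Integration.integral_sum i)
    also have "\<dots> \<le> (\<Sum>k<N. 8 * (1/2) ^ k)" by (intro sum_mono err)
    also have "\<dots> = 8 * (\<Sum>k<N. (1/2) ^ k)" by (simp add: sum_distrib_left)
    also have "\<dots> \<le> 8 * 2" by (intro mult_left_mono) (auto simp: sum_gp_strict)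
    finally show ?thesis by simp
  qed
  have "(\<Sum>j=1..(\<Sum>k<N. q k). psi b c (x + real j * \<alpha>)) = (\<Sum>k<N. X k x)" for N x
    unfolding sum_blocks X_def a_def by (simp add: algebra_simps)
  moreover have "(\<lambda>N. \<integral>x. iexp (s / sqrt (real N) * (\<Sum>k<N. X k x)) \<partial>circ) \<longlonglongrightarrow> of_real (exp (- (s\<^sup>2 * (1/3) / 2)))"
    by (rule iexp_L1_perturbation[OF circle_fun_sum[OF _ Xc] circle_fun_sum[OF _ Gc] total clt]) auto
  ultimately show ?thesis by (simp add: q_def)
qed

section \<open>Convergence in distribution for almost every parameter\<close>

lemma arc_borel [measurable]: "arc a b \<in> sets borel"
proof -
  have "arc a b = (\<Union>m::int. {a - of_int m..b - of_int m})"
    by (auto simp: arc_def algebra_simps)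
  then show ?thesis by simp
qed

lemma phi_borel [measurable]: "phi b c \<in> borel_measurable borel"
  unfolding phi_def[abs_def] by measurable

text \<open>
  An indicator of an arc minus its length is a difference of two fractional parts; the lengths cancel
  in \<open>phi\<close>.  At the right end points of the closed arcs the identity fails, hence the two
  exclusions.
\<close>
lemma phi_eq_saw:
  assumes b: "0 \<le> b" "b < 1" and x: "x - b \<notin> \<int>" "x - b - c \<notin> \<int>"
  shows "phi b c x = saw (x - b) - saw x - saw (x - b - c) + saw (x - c)"
proof -
  have *: "indicator (arc a (b + a)) y = b + frac (y - a - b) - frac (y - a)"
    if y: "y - a - b \<notin> \<int>" for y a :: real
  proof -
    define m where "m = \<lfloor>y - a\<rfloor>"
    define f where "f = frac (y - a)"
    have yf: "y - a = of_int m + f" by (simp add: m_def f_def frac_def)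
    have f: "0 \<le> f" "f < 1" by (auto simp: f_def frac_lt_1)
    have fb: "f \<noteq> b"
    proof
      assume "f = b" then have "y - a - b = of_int m" using yf by simp
      then show False using y by auto
    qed
    have "y \<in> arc a (b + a) \<longleftrightarrow> f \<le> b"
    proof
      assume "y \<in> arc a (b + a)"
      then obtain n :: int where n: "a \<le> y + of_int n" "y + of_int n \<le> b + a" by (auto simp: arc_def)
      have "0 \<le> of_int (m + n) + f" "of_int (m + n) + f \<le> b" using n yf by auto
      then have "of_int (m + n) > (-1::real)" using f by linarith
      then have "m + n \<ge> 0" by linarith
      then have "of_int (m + n) \<ge> (0::real)" by simp
      then show "f \<le> b" using \<open>of_int (m + n) + f \<le> b\<close> by linarith
    next
      assume "f \<le> b" then show "y \<in> arc a (b + a)"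
        using yf f by (auto simp: arc_def intro!: exI[of _ "-m"])
    qed
    moreover have "frac (y - a - b) = (if f \<le> b then f - b + 1 else f - b)"
      unfolding frac_unique_iff using yf f b fb by (auto simp: algebra_simps)
    ultimately show ?thesis by (simp add: f_def[symmetric])
  qed
  show ?thesis
    using *[of x 0] *[of x c] x by (simp add: phi_def saw_def algebra_simps)
qed

lemma AE_phi_eq_psi:
  assumes "0 \<le> b" "b < 1"
  shows "AE x in circ. \<forall>j. phi b c (x + real j * \<alpha>) = psi b c (x + real j * \<alpha>)"
proof -
  define E where "E = (\<Union>j::nat. \<Union>m::int. {of_int m + b - real j * \<alpha>, of_int m + b + c - real j * \<alpha>})"
  have "countable E" unfolding E_def by (intro countable_UN) auto
  then have "E \<in> null_sets lborel" by (rule countable_imp_null_set_lborel)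
  then have "AE x in lborel. x \<notin> E" by (rule AE_not_in)
  then have "AE x in circ. x \<notin> E" unfolding circ_def by (subst AE_restrict_space_iff) auto
  then show ?thesis
  proof eventually_elim
    case (elim x)
    show ?case
    proof
      fix j
      have "x + real j * \<alpha> - b \<noteq> of_int m" "x + real j * \<alpha> - b - c \<noteq> of_int m" for m
      proof -
        have "x \<noteq> of_int m + b - real j * \<alpha>" "x \<noteq> of_int m + b + c - real j * \<alpha>"
          using elim unfolding E_def by blast+
        then show "x + real j * \<alpha> - b \<noteq> of_int m" "x + real j * \<alpha> - b - c \<noteq> of_int m" by linarith+
      qed
      then show "phi b c (x + real j * \<alpha>) = psi b c (x + real j * \<alpha>)"
        unfolding psi_def using assms by (intro phi_eq_saw) (auto elim!: Ints_cases)
    qed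
  qed
qed

lemma integral_lebesgue_on_unit:
  fixes f :: "real \<Rightarrow> 'a::{banach,second_countable_topology}"
  assumes [measurable]: "f \<in> borel_measurable borel"
  shows "(\<integral>x. f x \<partial>lebesgue_on {0..<1}) = (\<integral>x. f x \<partial>circ)"
  unfolding circ_integral_eq by (simp add: integral_restrict_space integral_completion)

lemma prob_space_lebesgue_on_unit: "prob_space (lebesgue_on {0..<1::real})"
  by (rule prob_spaceI) (simp add: space_restrict_space emeasure_restrict_space)

lemma char_distr_unit:
  assumes [measurable]: "f \<in> borel_measurable borel"
  shows "char (distr (lebesgue_on {0..<1}) borel f) s = (\<integral>x. iexp (s * f x) \<partial>circ)"
proof -
  have "f \<in> borel_measurable (lebesgue_on {0..<1})"
    by (intro measurable_restrict_space1 measurable_completion) simp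
  then have "char (distr (lebesgue_on {0..<1}) borel f) s = (\<integral>x. iexp (s * f x) \<partial>lebesgue_on {0..<1})"
    unfolding char_def by (subst integral_distr) auto
  also have "\<dots> = (\<integral>x. iexp (s * f x) \<partial>circ)" by (rule integral_lebesgue_on_unit) measurable
  finally show ?thesis .
qed

theorem mainTheorem6:
  fixes \<alpha> :: real
  assumes "\<alpha> \<in> {0<..<1}" and "\<alpha> \<notin> \<rat>" and "\<not> bounded_type \<alpha>"
  shows "\<exists>t :: nat \<Rightarrow> nat. strict_mono_on {1..} t \<and>
    (AE (\<beta>, \<gamma>) in lebesgue_on ({0..<1} \<times> {0..<1}).
      weak_conv_m
        (\<lambda>N. distr (lebesgue_on {0..<1}) borel
          (\<lambda>x. sqrt 3 / sqrt (real N) *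
            (\<Sum>j = 1..(\<Sum>k = 1..N. cf_denom \<alpha> (t k)). phi \<beta> \<gamma> (x + real j * \<alpha>))))
        std_normal_distribution)"
proof -
  obtain u where u: "strict_mono u" "\<And>k. partial_quotient \<alpha> (Suc (u k)) \<ge> 2 ^ k"
    "\<And>k. (\<Sum>j<k. cf_denom \<alpha> (u j)) * 2 ^ k \<le> cf_denom \<alpha> (u k)"
    using sparse_denominators[OF assms(2,3)] by blast
  define q where "q k = cf_denom \<alpha> (u k)" for k
  have q: "lacunary q" using u(3) cf_denom_pos[OF assms(2)] by (simp add: lacunary_def q_def)
  \<comment> \<open>the blocks are counted from 1 in the claim and from 0 elsewhere\<close>
  define t where "t k = u (k - 1)" for k
  have L: "(\<Sum>k = 1..N. cf_denom \<alpha> (t k)) = (\<Sum>k<N. q k)" for N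
    by (simp add: sum.atLeast1_atMost_eq t_def q_def)
  have t: "strict_mono_on {1..} t"
    unfolding t_def by (intro strict_mono_onI strict_monoD[OF u(1)]) auto
  define P where "P z \<longleftrightarrow> (\<lambda>N. (\<Sum>k<N. corr (real (q k) * z)) / real N) \<longlonglongrightarrow> 0" for z
  have P: "AE z in lborel. P z" unfolding P_def
    by (rule LLN_lacunary[OF circle_fun_corr L1_lip_corr integral_corr q]) simp
  have conv: "weak_conv_m
        (\<lambda>N. distr (lebesgue_on {0..<1}) borel
          (\<lambda>x. sqrt 3 / sqrt (real N) *
            (\<Sum>j = 1..(\<Sum>k = 1..N. cf_denom \<alpha> (t k)). phi \<beta> \<gamma> (x + real j * \<alpha>))))
        std_normal_distribution"
    if b: "\<beta> \<in> {0..<1}" and Pz: "P \<beta>" "P \<gamma>" "P (\<beta> - \<gamma>)" "P (\<beta> + \<gamma>)" for \<beta> \<gamma>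
  proof -
    define X where "X N x = sqrt 3 / sqrt (real N) * (\<Sum>j=1..(\<Sum>k<N. q k). phi \<beta> \<gamma> (x + real j * \<alpha>))" for N x
    have X[measurable]: "X N \<in> borel_measurable borel" for N unfolding X_def by measurable
    have "weak_conv_m (\<lambda>N. distr (lebesgue_on {0..<1}) borel (X N)) std_normal_distribution"
    proof (rule levy_continuity)
      fix N
      interpret L: prob_space "lebesgue_on {0..<1::real}" by (rule prob_space_lebesgue_on_unit)
      have "X N \<in> borel_measurable (lebesgue_on {0..<1})"
        by (intro measurable_restrict_space1 measurable_completion) simp
      then show "real_distribution (distr (lebesgue_on {0..<1}) borel (X N))"
        by (rule L.real_distribution_distr)
    next
      show "real_distribution std_normal_distribution" by (rule real_dist_normal_dist)
    next
      fix s
      let ?S = "\<lambda>N x. \<Sum>j=1..(\<Sum>k<N. q k). psi \<beta> \<gamma> (x + real j * \<alpha>)"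
      have psi_meas[measurable]: "psi \<beta> \<gamma> \<in> borel_measurable borel" by (rule circle_funD(1)[OF circle_fun_psi])
      have "(\<lambda>N. \<integral>x. iexp ((s * sqrt 3) / sqrt (real N) * ?S N x) \<partial>circ) \<longlonglongrightarrow> of_real (exp (- ((s * sqrt 3)\<^sup>2 / 6)))"
        unfolding q_def
        by (rule CLT_psi[OF assms(1,2) u(2)]) (use q Pz in \<open>auto simp: q_def[abs_def] P_def\<close>)
      moreover have "(\<integral>x. iexp ((s * sqrt 3) / sqrt (real N) * ?S N x) \<partial>circ) = char (distr (lebesgue_on {0..<1}) borel (X N)) s" for N
        unfolding char_distr_unit[OF X]
      proof (rule integral_cong_AE)
        show "AE x in circ. iexp ((s * sqrt 3) / sqrt (real N) * ?S N x) = iexp (s * X N x)"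
          using AE_phi_eq_psi[of \<beta> \<gamma> \<alpha>] b by (auto simp: X_def mult.assoc elim!: eventually_mono)
      qed (intro measurable_circI; measurable)+
      moreover have "complex_of_real (exp (- ((s * sqrt 3)\<^sup>2 / 6))) = char std_normal_distribution s"
        by (simp add: char_std_normal_distribution power_mult_distrib)
      ultimately show "(\<lambda>N. char (distr (lebesgue_on {0..<1}) borel (X N)) s) \<longlonglongrightarrow> char std_normal_distribution s"
        by simp
    qed
    then show ?thesis unfolding L X_def[abs_def] .
  qed
  define W where "W \<beta> \<gamma> \<longleftrightarrow> weak_conv_m
        (\<lambda>N. distr (lebesgue_on {0..<1}) borel
          (\<lambda>x. sqrt 3 / sqrt (real N) *
            (\<Sum>j = 1..(\<Sum>k = 1..N. cf_denom \<alpha> (t k)). phi \<beta> \<gamma> (x + real j * \<alpha>))))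
        std_normal_distribution" for \<beta> \<gamma>
  have "AE p in lborel. P (fst p) \<and> P (snd p) \<and> P (fst p - snd p) \<and> P (fst p + snd p)"
    using AE_lborel_linear_form[OF P, of 1 0] AE_lborel_linear_form[OF P, of 0 1]
      AE_lborel_linear_form[OF P, of 1 "-1"] AE_lborel_linear_form[OF P, of 1 1] by simp
  then have "AE p in lebesgue. P (fst p) \<and> P (snd p) \<and> P (fst p - snd p) \<and> P (fst p + snd p)"
    by (rule AE_completion)
  then have ae: "AE p in lebesgue. p \<in> {0..<1} \<times> {0..<1} \<longrightarrow> W (fst p) (snd p)"
  proof eventually_elim
    case (elim p)
    then show ?case unfolding W_def by (intro impI conv) auto
  qed
  have "{0..<1} \<times> {0..<1} \<in> sets (borel :: (real \<times> real) measure)"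
    unfolding borel_prod[symmetric] by measurable
  then have "AE p in lebesgue_on ({0..<1} \<times> {0..<1}). W (fst p) (snd p)"
    using ae by (subst AE_restrict_space_iff) auto
  then show ?thesis using t unfolding W_def case_prod_beta by blast
qed

end
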